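(* Let $\mathbf{u}$ and $\mathbf{v}$ be $TB$-sequences in an abelian group $G$ and let $H$ be an arbitrary subgroup of $G$ containing (all terms of) $\mathbf{u}$ and $\mathbf{v}$. Then $\tau_{\mathbf{u}}=\tau_{\mathbf{v}}$ if and only if $\tau_{\mathbf{u}}(H)=\tau_{\mathbf{v}}(H)$.
   Context: All topological groups are Hausdorff and abelian. A group topology on $G$ is precompact if it is Hausdorff and for every neighborhood $U$ of $0$ there is a finite $F\subseteq G$ with $F+U=G$. A sequence $\mathbf{u}=(u_n)$ in an abelian group $G$ is a $TB$-sequence if there is a precompact group topology on $G$ in which $u_n\to0$; then $\tau_{\mathbf{u}}$ denotes the finest precompact group topology on $G$ in which $u_n\to 0$. If $\mathbf{u}$ is a $TB$-sequence in $G$ and $H$ is a subgroup of $G$ containing all terms of $\mathbf{u}$, then $\mathbf{u}$ is a $TB$-sequence in $H$, and $\tau_{\mathbf{u}}(H)$ denotes the finest precompact group topology on $H$ in which $\mathbf{u}$ converges to $0$. *)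

theory Defs
  imports "HOL-Analysis.Analysis" "HOL-Algebra.Coset"
begin

text \<open>Groups are written multiplicatively, as in \<^theory>\<open>HOL-Algebra.Group\<close>; a topology on a
  group \<open>G\<close> is an abstract topology whose \<open>topspace\<close> is the carrier of \<open>G\<close>.\<close>

definition group_topology :: "('a, 'm) monoid_scheme \<Rightarrow> 'a topology \<Rightarrow> bool" where
  "group_topology G T \<longleftrightarrow>
     topspace T = carrier G \<and>
     continuous_map (prod_topology T T) T (\<lambda>(x, y). x \<otimes>\<^bsub>G\<^esub> y) \<and>
     continuous_map T T (\<lambda>x. inv\<^bsub>G\<^esub> x)"

definition precompact_group_topology :: "('a, 'm) monoid_scheme \<Rightarrow> 'a topology \<Rightarrow> bool" where
  "precompact_group_topology G T \<longleftrightarrow>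
     group_topology G T \<and> Hausdorff_space T \<and>
     (\<forall>U. U \<subseteq> carrier G \<and> \<one>\<^bsub>G\<^esub> \<in> T interior_of U \<longrightarrow>
        (\<exists>F. finite F \<and> F \<subseteq> carrier G \<and> F <#>\<^bsub>G\<^esub> U = carrier G))"

definition precompact_null_topology ::
    "('a, 'm) monoid_scheme \<Rightarrow> (nat \<Rightarrow> 'a) \<Rightarrow> 'a topology \<Rightarrow> bool" where
  "precompact_null_topology G u T \<longleftrightarrow>
     precompact_group_topology G T \<and> limitin T u \<one>\<^bsub>G\<^esub> sequentially"

text \<open>The range condition is needed because \<^const>\<open>limitin\<close> only constrains the tail of a
  sequence.\<close>

definition TB_sequence :: "('a, 'm) monoid_scheme \<Rightarrow> (nat \<Rightarrow> 'a) \<Rightarrow> bool" where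
  "TB_sequence G u \<longleftrightarrow> range u \<subseteq> carrier G \<and> (\<exists>T. precompact_null_topology G u T)"

text \<open>The description below is proper exactly when a finest such topology exists, which is the
  case for every TB-sequence in an abelian group; uniqueness is immediate.\<close>

definition TB_topology :: "('a, 'm) monoid_scheme \<Rightarrow> (nat \<Rightarrow> 'a) \<Rightarrow> 'a topology" where
  "TB_topology G u =
     (THE T. precompact_null_topology G u T \<and>
        (\<forall>S. precompact_null_topology G u S \<longrightarrow> (\<forall>U. openin S U \<longrightarrow> openin T U)))"

end

theory Submission
  imports Defs "HOL-Library.Function_Algebras" "HOL-Algebra.FiniteProduct"
begin

text \<open>
  The topologies in question are finest ones, so an equality between two of them only asks
  whether each sequence is null in the finest topology of the other.

  If the topologies on \<open>H\<close> agree, this is immediate: the trace of \<open>\<tau>\<^sub>u\<close> on \<open>H\<close> is a precompact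
  topology in which \<open>u\<close> is null, so it is coarser than \<open>\<tau>\<^sub>u(H) = \<tau>\<^sub>v(H)\<close>, and \<open>v\<close> is null in it.

  Conversely let \<open>\<tau>\<^sub>u = \<tau>\<^sub>v\<close> and let \<open>\<phi>\<close> be a \<open>\<tau>\<^sub>u(H)\<close>-continuous character of \<open>H\<close>. The circle is
  divisible, so \<open>\<phi>\<close> extends to a character \<open>\<psi>\<close> of \<open>G\<close> (\<open>character_extension\<close>). Since
  \<open>\<psi>(u\<^sub>n) = \<phi>(u\<^sub>n) \<rightarrow> 1\<close>, joining to \<open>\<tau>\<^sub>u\<close> the topology induced by \<open>\<psi>\<close> gives a precompact topology in
  which \<open>u\<close> is still null. It cannot be strictly finer than \<open>\<tau>\<^sub>u\<close>, so \<open>\<psi>\<close> is continuous for \<open>\<tau>\<^sub>u = \<tau>\<^sub>v\<close> and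
  \<open>\<phi>(v\<^sub>n) = \<psi>(v\<^sub>n) \<rightarrow> 1\<close>. This gives \<open>v\<^sub>n \<rightarrow> 0\<close> in \<open>\<tau>\<^sub>u(H)\<close>, because a totally bounded group topology
  is determined by its continuous characters
  (\<open>characters_determine_totally_bounded_topology\<close>).

  That last fact is the Peter-Weyl theorem for compact abelian groups. It is derived here by
  finite Fourier analysis, following Bogolyubov and Folner. Let \<open>x\<^sub>0\<close> lie outside a neighbourhood
  \<open>U\<close>. Take a small neighbourhood \<open>V\<close> of which \<open>N\<close> translates cover the group, and a function \<open>f\<close>
  that is \<open>1\<close> on \<open>V\<close>, vanishes outside \<open>V + V\<close> and changes by very little under translation by
  the elements of a much smaller neighbourhood \<open>W\<close> (\<open>bump_exists\<close>). Finitely many group elements,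
  \<open>x\<^sub>0\<close> among them, give a homomorphism from some \<open>\<int>\<^sup>k\<close> along which \<open>f\<close> can be pulled back and cut
  off to a box; the box is placed in a finite cyclic power, and a counting argument there finds a
  frequency at which the Fourier coefficient of \<open>f\<close> is at least a constant depending on \<open>N\<close> alone,
  and which moves \<open>x\<^sub>0\<close> by at least such a constant (\<open>large_frequency\<close>). A large coefficient of a
  function that is nearly invariant under \<open>W\<close> forces the frequency to stay within distance \<open>1\<close> of
  \<open>1\<close> on \<open>W\<close> (\<open>trig_sum_shift\<close>), which is enough for a character to be continuous
  (\<open>equicontinuous_characters\<close>). None of the bounds depends on \<open>k\<close>, so compactness of the space of all angle
  assignments turns these approximate characters into a character that is continuous and
  nontrivial at \<open>x\<^sub>0\<close> (\<open>bump.character_exists\<close>).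
\<close>

section \<open>Finite Fourier analysis on boxes of integer vectors\<close>

text \<open>The character of the free abelian group on \<open>I\<close> that rotates the generator \<open>i\<close> by the angle \<open>\<theta> i\<close>.
  Keeping angles instead of points of the circle makes the space of such characters a product of
  compact intervals.\<close>

definition phase :: "'i set \<Rightarrow> ('i \<Rightarrow> real) \<Rightarrow> ('i \<Rightarrow> int) \<Rightarrow> complex" where
  "phase I \<theta> d = cis (\<Sum>i\<in>I. \<theta> i * of_int (d i))"

text \<open>Vectors vanish outside \<open>I\<close>, so that they add pointwise and two of them that agree on \<open>I\<close>
  are equal.\<close>

definition cube :: "'i set \<Rightarrow> int \<Rightarrow> int \<Rightarrow> ('i \<Rightarrow> int) set" where
  "cube I l h = {y. \<forall>i. if i \<in> I then l \<le> y i \<and> y i < h else y i = 0}"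

lemma cubeD:
  assumes "y \<in> cube I l h"
  shows "i \<in> I \<Longrightarrow> l \<le> y i" "i \<in> I \<Longrightarrow> y i < h" "i \<notin> I \<Longrightarrow> y i = 0"
  using assms unfolding cube_def mem_Collect_eq by presburger+

lemma cubeI:
  assumes "\<And>i. i \<in> I \<Longrightarrow> l \<le> y i \<and> y i < h" "\<And>i. i \<notin> I \<Longrightarrow> y i = 0"
  shows "y \<in> cube I l h"
  using assms by (simp add: cube_def)

lemma phase_add: "phase I \<theta> (c + d) = phase I \<theta> c * phase I \<theta> d"
  by (simp add: phase_def cis_mult ring_distribs sum.distrib)

lemma phase_diff: "phase I \<theta> (c - d) = phase I \<theta> c * cnj (phase I \<theta> d)"
  by (simp add: phase_def cis_mult right_diff_distrib sum_subtractf cis_cnj)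

lemma norm_phase [simp]: "norm (phase I \<theta> d) = 1"
  by (simp add: phase_def)

lemma phase_superset:
  assumes "finite J" "I \<subseteq> J" "\<And>i. i \<in> J - I \<Longrightarrow> d i = 0"
  shows "phase J \<theta> d = phase I \<theta> d"
proof -
  have "(\<Sum>i\<in>J. \<theta> i * of_int (d i)) = (\<Sum>i\<in>I. \<theta> i * of_int (d i))"
    using assms by (intro sum.mono_neutral_right) auto
  then show ?thesis by (simp add: phase_def)
qed

lemma cube_card:
  assumes "finite I"
  shows finite_cube: "finite (cube I l h)" and card_cube: "card (cube I l h) = nat (h - l) ^ card I"
proof -
  let ?f = "\<lambda>y i. if i \<in> I then y i else (0::int)"
  have im: "?f ` (I \<rightarrow>\<^sub>E {l..<h}) = cube I l h"
  proof (intro equalityI subsetI)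
    fix y assume y: "y \<in> cube I l h"
    then have "y = ?f (restrict y I)"
      by (auto simp: cube_def fun_eq_iff)
    moreover have "restrict y I \<in> I \<rightarrow>\<^sub>E {l..<h}"
      using y by (auto simp: cube_def)
    ultimately show "y \<in> ?f ` (I \<rightarrow>\<^sub>E {l..<h})" by blast
  qed (auto simp: cube_def PiE_iff)
  have inj: "inj_on ?f (I \<rightarrow>\<^sub>E {l..<h})"
    by (rule inj_onI, rule PiE_ext) (auto simp: fun_eq_iff, metis+)
  show "finite (cube I l h)"
    unfolding im [symmetric] using assms by (intro finite_imageI finite_PiE) auto
  show "card (cube I l h) = nat (h - l) ^ card I"
    unfolding im [symmetric] card_image [OF inj] using assms by (simp add: card_funcsetE)
qed

lemma cis_sum:
  assumes "finite I"
  shows "cis (\<Sum>i\<in>I. f i) = (\<Prod>i\<in>I. cis (f i))"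
  using assms by (induction I) (simp_all flip: cis_mult)

lemma sum_roots_of_unity:
  fixes n :: int
  assumes "\<bar>n\<bar> < int M"
  shows "(\<Sum>a<M. cis (2 * pi * real a / real M * of_int n)) = (if n = 0 then of_nat M else 0)"
proof (cases "n = 0")
  case False
  define z where "z = cis (2 * pi * of_int n / real M)"
  have M: "M > 0" using assms by linarith
  have "cis (2 * pi * real a / real M * of_int n) = z ^ a" for a
    by (simp add: z_def Complex.DeMoivre algebra_simps)
  moreover have "z ^ M = 1"
    using M by (simp add: z_def Complex.DeMoivre cis_multiple_2pi)
  moreover have "z \<noteq> 1"
  proof
    assume "z = 1"
    then have "cos (2 * pi * of_int n / real M) = 1"
      by (simp add: z_def complex_eq_iff)
    then obtain k :: int where "2 * pi * of_int n / real M = of_int k * 2 * pi"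
      by (auto simp: cos_one_2pi_int)
    then have "real_of_int n = of_int k * real M"
      using M by (simp add: field_simps)
    then have "n = k * int M"
      by (metis of_int_eq_iff of_int_mult of_int_of_nat_eq)
    with assms False show False
      by (metis abs_mult abs_of_nat dvd_triv_right zdvd_imp_le abs_ge_zero abs_eq_0 dvd_abs_iff linorder_not_less order_le_less)
  qed
  ultimately show ?thesis using False by (simp add: geometric_sum)
qed simp

text \<open>The angles belonging to a character of the group \<open>(\<int>/M)\<^sup>I\<close>.\<close>

definition freq :: "'i set \<Rightarrow> nat \<Rightarrow> ('i \<Rightarrow> nat) \<Rightarrow> 'i \<Rightarrow> real" where
  "freq I M a i = (if i \<in> I then 2 * pi * real (a i) / real M else 0)"

text \<open>Orthogonality of characters: the sum factors over the coordinates into sums of roots of unity.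
  The bound on the entries makes divisibility by \<open>M\<close> the same as being zero.\<close>

lemma sum_phase_freq:
  assumes "finite I" and "\<And>i. i \<in> I \<Longrightarrow> \<bar>d i\<bar> < int M"
  shows "(\<Sum>a\<in>I \<rightarrow>\<^sub>E {..<M}. phase I (freq I M a) d) =
           (if \<forall>i\<in>I. d i = 0 then of_nat M ^ card I else 0)"
proof -
  have "phase I (freq I M a) d = (\<Prod>i\<in>I. cis (2 * pi * real (a i) / real M * of_int (d i)))" for a
    by (simp add: phase_def freq_def cis_sum [OF assms(1)] cong: sum.cong prod.cong)
  then have "(\<Sum>a\<in>I \<rightarrow>\<^sub>E {..<M}. phase I (freq I M a) d) =
      (\<Sum>a\<in>I \<rightarrow>\<^sub>E {..<M}. \<Prod>i\<in>I. cis (2 * pi * real (a i) / real M * of_int (d i)))"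
    by simp
  also have "\<dots> = (\<Prod>i\<in>I. \<Sum>a<M. cis (2 * pi * real a / real M * of_int (d i)))"
    using assms(1) by (subst prod_sum_PiE) auto
  also have "\<dots> = (\<Prod>i\<in>I. if d i = 0 then of_nat M else 0)"
    by (intro prod.cong refl sum_roots_of_unity assms(2))
  also have "\<dots> = (if \<forall>i\<in>I. d i = 0 then of_nat M ^ card I else 0)"
    using assms(1) by auto
  finally show ?thesis .
qed

lemma cube_mono:
  assumes "h \<le> h'"
  shows "cube I l h \<subseteq> cube I l h'"
  using assms by (auto intro!: cubeI dest: cubeD)

lemma sum_phase_freq_weighted:
  assumes "finite I" and "finite P" and "\<And>p i. p \<in> P \<Longrightarrow> i \<in> I \<Longrightarrow> \<bar>n p i\<bar> < int M"
  shows "(\<Sum>a\<in>I \<rightarrow>\<^sub>E {..<M}. \<Sum>p\<in>P. w p * phase I (freq I M a) (n p)) =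
           of_nat M ^ card I * (\<Sum>p\<in>{p \<in> P. \<forall>i\<in>I. n p i = 0}. w p)"
proof -
  have "(\<Sum>a\<in>I \<rightarrow>\<^sub>E {..<M}. \<Sum>p\<in>P. w p * phase I (freq I M a) (n p)) =
      (\<Sum>p\<in>P. w p * (\<Sum>a\<in>I \<rightarrow>\<^sub>E {..<M}. phase I (freq I M a) (n p)))"
    by (subst sum.swap) (simp add: sum_distrib_left)
  also have "\<dots> = (\<Sum>p\<in>P. if \<forall>i\<in>I. n p i = 0 then w p * of_nat M ^ card I else 0)"
    using assms(1,3) by (intro sum.cong refl) (simp add: sum_phase_freq)
  also have "\<dots> = (\<Sum>p\<in>{p \<in> P. \<forall>i\<in>I. n p i = 0}. w p * of_nat M ^ card I)"
    using assms(2) by (intro sum.mono_neutral_cong_right) auto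
  finally show ?thesis by (simp add: sum_distrib_left mult.commute)
qed

definition trig_sum :: "'i set \<Rightarrow> ('i \<Rightarrow> int) set \<Rightarrow> (('i \<Rightarrow> int) \<Rightarrow> real) \<Rightarrow> ('i \<Rightarrow> real) \<Rightarrow> complex" where
  "trig_sum I A g \<theta> = (\<Sum>y\<in>A. of_real (g y) * phase I \<theta> y)"

lemma norm_trig_sum_squared:
  "of_real ((norm (trig_sum I A g \<theta>))\<^sup>2) =
     (\<Sum>(y, z)\<in>A \<times> A. of_real (g y * g z) * phase I \<theta> (y - z))"
proof -
  have "of_real ((norm (trig_sum I A g \<theta>))\<^sup>2) = trig_sum I A g \<theta> * cnj (trig_sum I A g \<theta>)"
    by (rule complex_norm_square)
  also have "\<dots> = (\<Sum>y\<in>A. \<Sum>z\<in>A. of_real (g y * g z) * phase I \<theta> (y - z))"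
    by (simp add: trig_sum_def sum_product phase_diff mult_ac)
  finally show ?thesis by (simp add: sum.cartesian_product)
qed

lemma norm_trig_sum_le:
  assumes "\<And>y. y \<in> A \<Longrightarrow> 0 \<le> g y \<and> g y \<le> 1"
  shows "norm (trig_sum I A g \<theta>) \<le> card A"
proof -
  have "norm (trig_sum I A g \<theta>) \<le> (\<Sum>y\<in>A. 1)"
    unfolding trig_sum_def using assms by (intro sum_norm_le) (auto simp: norm_mult)
  then show ?thesis by simp
qed

text \<open>Parseval's identity for an indicator function.\<close>

lemma sum_norm_trig_sum_squared:
  assumes "finite I" "A \<subseteq> cube I 0 (int M)"
  shows "(\<Sum>a\<in>I \<rightarrow>\<^sub>E {..<M}. (norm (trig_sum I A (\<lambda>_. 1) (freq I M a)))\<^sup>2) =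
           real M ^ card I * real (card A)"
proof -
  have finA: "finite A"
    using assms finite_cube finite_subset by blast
  have "complex_of_real (\<Sum>a\<in>I \<rightarrow>\<^sub>E {..<M}. (norm (trig_sum I A (\<lambda>_. 1) (freq I M a)))\<^sup>2) =
      (\<Sum>a\<in>I \<rightarrow>\<^sub>E {..<M}. \<Sum>p\<in>A \<times> A. 1 * phase I (freq I M a) (fst p - snd p))"
    by (simp only: of_real_sum norm_trig_sum_squared) (simp add: case_prod_unfold)
  also have "\<dots> = of_nat M ^ card I * (\<Sum>p\<in>{p \<in> A \<times> A. \<forall>i\<in>I. (fst p - snd p) i = 0}. 1)"
  proof (rule sum_phase_freq_weighted)
    fix p i assume "p \<in> A \<times> A" "i \<in> I"
    then have "fst p \<in> cube I 0 (int M)" "snd p \<in> cube I 0 (int M)" using assms by auto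
    with \<open>i \<in> I\<close> have "0 \<le> fst p i" "fst p i < int M" "0 \<le> snd p i" "snd p i < int M"
      by (auto simp: cube_def)
    then show "\<bar>(fst p - snd p) i\<bar> < int M" by simp
  qed (use assms finA in auto)
  also have "{p \<in> A \<times> A. \<forall>i\<in>I. (fst p - snd p) i = 0} = (\<lambda>y. (y, y)) ` A"
  proof -
    have "y = z" if "y \<in> A" "z \<in> A" "\<forall>i\<in>I. y i = z i" for y z
    proof
      fix i
      have "y \<in> cube I 0 (int M)" "z \<in> cube I 0 (int M)" using that assms by auto
      then show "y i = z i" using that(3) by (cases "i \<in> I") (auto simp: cube_def)
    qed
    then have "fst p = snd p" if "p \<in> A \<times> A" "\<forall>i\<in>I. (fst p - snd p) i = 0" for p
      using that by (simp add: mem_Times_iff)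
    then show ?thesis by (auto simp: image_iff)
  qed
  also have "(\<Sum>p\<in>(\<lambda>y. (y, y)) ` A. 1) = (of_nat (card A) :: complex)"
    by (subst sum.reindex) (auto simp: inj_on_def)
  finally have "complex_of_real (\<Sum>a\<in>I \<rightarrow>\<^sub>E {..<M}. (norm (trig_sum I A (\<lambda>_. 1) (freq I M a)))\<^sup>2)
      = complex_of_real (real M ^ card I * real (card A))"
    by simp
  then show ?thesis using of_real_eq_iff by blast
qed

definition unit_vec :: "'i \<Rightarrow> 'i \<Rightarrow> int" where
  "unit_vec i = (\<lambda>j. if j = i then 1 else 0)"

lemma phase_unit_vec:
  assumes "finite I" "i \<in> I"
  shows "phase I \<theta> (unit_vec i) = cis (\<theta> i)"
proof -
  have "(\<Sum>j\<in>I. \<theta> j * real_of_int (unit_vec i j)) = (\<Sum>j\<in>I. if j = i then \<theta> j else 0)"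
    by (intro sum.cong) (auto simp: unit_vec_def)
  then show ?thesis using assms by (simp add: phase_def)
qed

text \<open>Expanding the two squared moduli, the sum counts with weights \<open>g r * g s\<close> the solutions of
  \<open>y - y' + (r - s) + unit_vec i0 = 0\<close> modulo \<open>Q + R\<close>. All entries of the left-hand side are smaller
  than \<open>Q + R\<close> in absolute value, so there is no wrap-around: a solution of the congruence solves the
  equation over the integers, which the last hypothesis excludes.\<close>

lemma twisted_trig_sum_zero:
  fixes g :: "('i \<Rightarrow> int) \<Rightarrow> real"
  assumes I: "finite I" "i0 \<in> I"
    and A: "A \<subseteq> cube I 0 (int Q)"
    and disj: "\<And>y y' r s. y \<in> A \<Longrightarrow> y' \<in> A \<Longrightarrow> r \<in> cube I 0 (int R) \<Longrightarrow> s \<in> cube I 0 (int R) \<Longrightarrow>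
        g r \<noteq> 0 \<Longrightarrow> g s \<noteq> 0 \<Longrightarrow> y + r + unit_vec i0 \<noteq> y' + s"
  shows "(\<Sum>a\<in>I \<rightarrow>\<^sub>E {..<Q + R}. (norm (trig_sum I A (\<lambda>_. 1) (freq I (Q + R) a)))\<^sup>2 *
            (norm (trig_sum I (cube I 0 (int R)) g (freq I (Q + R) a)))\<^sup>2 *
            cos (freq I (Q + R) a i0)) = 0" (is "(\<Sum>a\<in>_. ?X a * ?Y a * _) = 0")
proof -
  let ?B = "cube I 0 (int R)"
  let ?P = "(A \<times> A) \<times> (?B \<times> ?B)"
  let ?n = "\<lambda>p :: (('i \<Rightarrow> int) \<times> ('i \<Rightarrow> int)) \<times> (('i \<Rightarrow> int) \<times> ('i \<Rightarrow> int)).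
    (fst (fst p) - snd (fst p)) + (fst (snd p) - snd (snd p)) + unit_vec i0"
  let ?w = "\<lambda>p :: (('i \<Rightarrow> int) \<times> ('i \<Rightarrow> int)) \<times> (('i \<Rightarrow> int) \<times> ('i \<Rightarrow> int)).
    complex_of_real (g (fst (snd p)) * g (snd (snd p)))"
  have fin: "finite A" "finite ?B"
    using A I finite_cube finite_subset by blast+
  have term_eq: "complex_of_real (?X a * ?Y a) * cis (freq I (Q + R) a i0) =
      (\<Sum>p\<in>?P. ?w p * phase I (freq I (Q + R) a) (?n p))" for a
  proof -
    have "complex_of_real (?X a * ?Y a) =
        (\<Sum>p\<in>?P. ?w p * (phase I (freq I (Q + R) a) (fst (fst p) - snd (fst p)) *
           phase I (freq I (Q + R) a) (fst (snd p) - snd (snd p))))"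
      unfolding of_real_mult norm_trig_sum_squared sum_product sum.cartesian_product
      by (simp add: case_prod_unfold mult_ac)
    then have "complex_of_real (?X a * ?Y a) * cis (freq I (Q + R) a i0) =
        (\<Sum>p\<in>?P. ?w p * (phase I (freq I (Q + R) a) (fst (fst p) - snd (fst p)) *
           phase I (freq I (Q + R) a) (fst (snd p) - snd (snd p))) * cis (freq I (Q + R) a i0))"
      by (simp only: sum_distrib_right)
    also have "\<dots> = (\<Sum>p\<in>?P. ?w p * phase I (freq I (Q + R) a) (?n p))"
      by (intro sum.cong refl) (simp only: phase_add phase_unit_vec [OF I] mult.assoc)
    finally show ?thesis .
  qed
  have "(\<Sum>a\<in>I \<rightarrow>\<^sub>E {..<Q + R}. complex_of_real (?X a * ?Y a) * cis (freq I (Q + R) a i0)) =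
      of_nat (Q + R) ^ card I * (\<Sum>p\<in>{p \<in> ?P. \<forall>i\<in>I. ?n p i = 0}. ?w p)"
    unfolding term_eq
  proof (rule sum_phase_freq_weighted)
    fix p i assume p: "p \<in> ?P" and i: "i \<in> I"
    obtain y z r s where p_eq: "p = ((y, z), (r, s))" by (metis surj_pair)
    have "y \<in> cube I 0 (int Q)" "z \<in> cube I 0 (int Q)" "r \<in> ?B" "s \<in> ?B"
      using p A p_eq by auto
    with i have "0 \<le> y i" "y i < int Q" "0 \<le> z i" "z i < int Q"
      "0 \<le> r i" "r i < int R" "0 \<le> s i" "s i < int R"
      by (auto simp: cube_def)
    then show "\<bar>?n p i\<bar> < int (Q + R)" by (auto simp: p_eq unit_vec_def abs_less_iff)
  qed (use I fin in auto)
  also have "(\<Sum>p\<in>{p \<in> ?P. \<forall>i\<in>I. ?n p i = 0}. ?w p) = 0"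
  proof (rule sum.neutral, rule ballI)
    fix p assume p: "p \<in> {p \<in> ?P. \<forall>i\<in>I. ?n p i = 0}"
    obtain y z r s where p_eq: "p = ((y, z), (r, s))" by (metis surj_pair)
    have mem: "y \<in> A" "z \<in> A" "r \<in> ?B" "s \<in> ?B" using p p_eq by auto
    have "y + r + unit_vec i0 = z + s"
    proof
      fix i
      have "y \<in> cube I 0 (int Q)" "z \<in> cube I 0 (int Q)" using mem A by auto
      then show "(y + r + unit_vec i0) i = (z + s) i"
        using p p_eq mem(3,4) I(2) by (cases "i \<in> I") (auto simp: cube_def unit_vec_def algebra_simps)
    qed
    then show "?w p = 0"
      using disj [OF mem] by (auto simp: p_eq)
  qed
  finally have "(\<Sum>a\<in>I \<rightarrow>\<^sub>E {..<Q + R}. complex_of_real (?X a * ?Y a) * cis (freq I (Q + R) a i0)) = 0"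
    by simp
  then have "Re (\<Sum>a\<in>I \<rightarrow>\<^sub>E {..<Q + R}. complex_of_real (?X a * ?Y a) * cis (freq I (Q + R) a i0)) = 0"
    by simp
  then show ?thesis by (simp add: Re_sum)
qed

text \<open>Let \<open>X\<close> and \<open>Y\<close> be the squared moduli of the two sums. By \<open>twisted_trig_sum_zero\<close> the sum of \<open>X * Y * (1 - cos)\<close>
  equals the sum of \<open>X * Y\<close>, which the trivial frequency alone makes at least
  \<open>Q\<^sup>2\<^sup>k * R\<^sup>2\<^sup>k / N\<^sup>4\<close>. On the other hand, the total of \<open>X\<close> is at most \<open>2 * Q\<^sup>2\<^sup>k\<close> by Parseval, so the
  frequencies with small \<open>Y\<close> and those with small \<open>1 - cos\<close> together contribute less than that.
  The box of length \<open>R\<close> may be much shorter than the one of length \<open>Q\<close>, and this is what keeps the bounds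
  independent of the number of coordinates: the enlargement from \<open>Q\<close> to \<open>Q + R\<close> that prevents
  wrap-around costs only a factor \<open>2\<close>.\<close>

lemma large_frequency:
  fixes g :: "('i \<Rightarrow> int) \<Rightarrow> real"
  assumes I: "finite I" "i0 \<in> I" and N: "N > 0" and Q: "Q > 0" and R: "R > 0"
    and A: "A \<subseteq> cube I 0 (int Q)" "real Q ^ card I \<le> real N * card A"
    and g: "\<And>r. 0 \<le> g r" "\<And>r. g r \<le> 1"
    and sum_g: "real R ^ card I \<le> real N * (\<Sum>r\<in>cube I 0 (int R). g r)"
    and QR: "real (Q + R) ^ card I \<le> 2 * real Q ^ card I"
    and disj: "\<And>y y' r s. y \<in> A \<Longrightarrow> y' \<in> A \<Longrightarrow> r \<in> cube I 0 (int R) \<Longrightarrow> s \<in> cube I 0 (int R) \<Longrightarrow>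
        g r \<noteq> 0 \<Longrightarrow> g s \<noteq> 0 \<Longrightarrow> y + r + unit_vec i0 \<noteq> y' + s"
  obtains \<theta> where "\<And>i. \<theta> i \<in> {0..2 * pi}"
    and "real R ^ card I / (4 * real N ^ 2) \<le> norm (trig_sum I (cube I 0 (int R)) g \<theta>)"
    and "1 / (8 * real N ^ 4) \<le> 1 - cos (\<theta> i0)"
proof -
  let ?B = "cube I 0 (int R)" and ?F = "I \<rightarrow>\<^sub>E {..<Q + R}"
  define k where "k = card I"
  define X where "X a = (norm (trig_sum I A (\<lambda>_. 1) (freq I (Q + R) a)))\<^sup>2" for a
  define Y where "Y a = (norm (trig_sum I ?B g (freq I (Q + R) a)))\<^sup>2" for a
  define C where "C a = cos (freq I (Q + R) a i0)" for a
  have fin: "finite ?F" using I by (intro finite_PiE) auto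
  have cardB: "card ?B = R ^ k" using card_cube [OF I(1), of 0 "int R"] by (simp add: k_def)
  have cardA: "real (card A) \<le> real Q ^ k"
    using card_mono [OF finite_cube [OF I(1)] A(1)] card_cube [OF I(1), of 0 "int Q"]
    by (simp add: k_def flip: of_nat_power)
  have X0: "X a \<ge> 0" and Y0: "Y a \<ge> 0" for a by (auto simp: X_def Y_def)
  have "\<exists>a\<in>?F. real R ^ k / (4 * real N ^ 2) \<le> norm (trig_sum I ?B g (freq I (Q + R) a)) \<and>
      1 / (8 * real N ^ 4) \<le> 1 - C a"
  proof (rule ccontr)
    assume neg: "\<not> ?thesis"
    \<comment> \<open>If the claim fails, \<open>L\<close> bounds \<open>Y a * (1 - C a)\<close> at every frequency.\<close>
    define L where "L = real R ^ (2 * k) / (8 * real N ^ 4)"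
    have YC: "Y a * (1 - C a) \<le> L" if "a \<in> ?F" for a
    proof (cases "real R ^ k / (4 * real N ^ 2) \<le> norm (trig_sum I ?B g (freq I (Q + R) a))")
      case True
      then have "1 - C a \<le> 1 / (8 * real N ^ 4)" using neg that by force
      moreover have "Y a \<le> real R ^ (2 * k)"
      proof -
        have "norm (trig_sum I ?B g (freq I (Q + R) a)) \<le> real R ^ k"
          using norm_trig_sum_le [of ?B g I] g by (simp add: cardB)
        then have "Y a \<le> (real R ^ k)\<^sup>2" unfolding Y_def by (intro power_mono) auto
        then show ?thesis by (simp add: power_mult mult.commute flip: power_mult)
      qed
      ultimately have "Y a * (1 - C a) \<le> real R ^ (2 * k) * (1 / (8 * real N ^ 4))"
        using Y0 by (intro mult_mono) (auto simp: C_def)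
      then show ?thesis by (simp add: L_def)
    next
      case False
      then have "Y a \<le> (real R ^ k / (4 * real N ^ 2))\<^sup>2"
        unfolding Y_def by (intro power_mono) auto
      also have "\<dots> = real R ^ (2 * k) / (16 * real N ^ 4)"
        by (simp add: power_divide power_mult_distrib mult.commute flip: power_mult)
      finally have "Y a * (1 - C a) \<le> real R ^ (2 * k) / (16 * real N ^ 4) * 2"
        using cos_ge_minus_one [of "freq I (Q + R) a i0"] Y0 
        by (intro mult_mono) (auto simp: C_def simp del: cos_ge_minus_one)
      then show ?thesis by (simp add: L_def)
    qed
    have "L > 0" using R N by (simp add: L_def)
    have "(\<Sum>a\<in>?F. X a * Y a * C a) = 0"
      unfolding X_def Y_def C_def using disj by (intro twisted_trig_sum_zero I A(1)) blast
    then have "(\<Sum>a\<in>?F. X a * Y a) = (\<Sum>a\<in>?F. X a * (Y a * (1 - C a)))"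
      by (simp add: right_diff_distrib sum_subtractf mult.assoc)
    also have "\<dots> \<le> (\<Sum>a\<in>?F. X a * L)"
      using YC X0 by (intro sum_mono mult_left_mono) auto
    also have "\<dots> = real (Q + R) ^ k * card A * L"
    proof -
      have "A \<subseteq> cube I 0 (int (Q + R))"
        using A(1) cube_mono [of "int Q" "int (Q + R)" I 0] by simp
      from sum_norm_trig_sum_squared [OF I(1) this] show ?thesis
        by (simp add: X_def k_def flip: sum_distrib_right)
    qed
    also have "\<dots> \<le> 2 * real Q ^ k * real Q ^ k * L"
      using QR cardA \<open>L > 0\<close> by (intro mult_right_mono mult_mono) (auto simp: k_def)
    finally have upper: "(\<Sum>a\<in>?F. X a * Y a) \<le> 2 * real Q ^ k * real Q ^ k * L" .
    define z where "z = (\<lambda>i\<in>I. 0 :: nat)"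
    have z: "z \<in> ?F" using Q by (auto simp: z_def)
    have "freq I (Q + R) z = (\<lambda>_. 0)" by (auto simp: freq_def z_def)
    then have ph: "phase I (freq I (Q + R) z) y = 1" for y by (simp add: phase_def)
    have Xz: "X z = (real (card A))\<^sup>2" by (simp add: X_def trig_sum_def ph)
    have Yz: "Y z = (\<Sum>r\<in>?B. g r)\<^sup>2" by (simp add: Y_def trig_sum_def ph flip: of_real_sum)
    have "(real Q ^ k)\<^sup>2 * (real R ^ k)\<^sup>2 \<le> (real N * card A)\<^sup>2 * (real N * (\<Sum>r\<in>?B. g r))\<^sup>2"
      using A(2) sum_g by (intro mult_mono power_mono) (auto simp: k_def)
    also have "\<dots> = real N ^ 4 * (X z * Y z)"
      by (simp add: Xz Yz power_mult_distrib)
    also have "\<dots> \<le> real N ^ 4 * (\<Sum>a\<in>?F. X a * Y a)"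
      using z fin X0 Y0 by (intro mult_left_mono member_le_sum) auto
    also have "\<dots> \<le> real N ^ 4 * (2 * real Q ^ k * real Q ^ k * L)"
      using upper by (intro mult_left_mono) auto
    also have "\<dots> = (real Q ^ k)\<^sup>2 * (real R ^ k)\<^sup>2 / 4"
    proof -
      have "L = (real R ^ k)\<^sup>2 / (8 * real N ^ 4)"
        by (simp add: L_def mult.commute flip: power_mult)
      then show ?thesis using N by (simp add: power2_eq_square)
    qed
    also have "\<dots> < (real Q ^ k)\<^sup>2 * (real R ^ k)\<^sup>2"
      using Q R by simp
    finally show False by simp
  qed
  then obtain a where a: "a \<in> ?F"
    "real R ^ k / (4 * real N ^ 2) \<le> norm (trig_sum I ?B g (freq I (Q + R) a))"
    "1 / (8 * real N ^ 4) \<le> 1 - C a" by blast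
  show thesis
  proof (rule that [of "freq I (Q + R) a"])
    show "freq I (Q + R) a i \<in> {0..2 * pi}" for i
    proof (cases "i \<in> I")
      case True
      with a(1) have "a i < Q + R" by auto
      then have "real (a i) / real (Q + R) \<le> 1" using Q by simp
      then have "2 * pi * (real (a i) / real (Q + R)) \<le> 2 * pi * 1" by (intro mult_left_mono) auto
      then show ?thesis using True by (simp add: freq_def)
    qed (simp add: freq_def)
  qed (use a in \<open>simp_all add: k_def C_def\<close>)
qed

text \<open>Multiplying the sum by \<open>phase I \<theta> d\<close> amounts to translating \<open>g\<close> by \<open>d\<close>. The two sums then differ by the
  variation of \<open>g\<close> where the box meets its translate, and by boundary terms elsewhere; the inner box with margin
  \<open>D\<close> lies in the common part.\<close>

lemma trig_sum_shift:
  fixes g :: "('i \<Rightarrow> int) \<Rightarrow> real" and D R :: nat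
  assumes I: "finite I" and d: "\<And>i. i \<notin> I \<Longrightarrow> d i = 0" "\<And>i. \<bar>d i\<bar> \<le> int D" and D: "2 * D \<le> R"
    and g: "\<And>r. 0 \<le> g r" "\<And>r. g r \<le> 1"
    and close: "\<And>r. r \<in> cube I 0 (int R) \<Longrightarrow> \<bar>g (r + d) - g r\<bar> \<le> \<epsilon>" and "\<epsilon> \<ge> 0"
  shows "norm (phase I \<theta> d - 1) * norm (trig_sum I (cube I 0 (int R)) g \<theta>) \<le>
           \<epsilon> * real R ^ card I + 2 * (real R ^ card I - real (R - 2 * D) ^ card I)"
proof -
  define B where "B = cube I 0 (int R)"
  define C where "C = {r \<in> B. r + d \<in> B}"
  define C' where "C' = (\<lambda>r. r + d) ` C"
  let ?p = "phase I \<theta>"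
  have finB: "finite B" using finite_cube I by (auto simp: B_def)
  have CB: "C \<subseteq> B" "C' \<subseteq> B" by (auto simp: C_def C'_def)
  have fin: "finite C" "finite C'" using finB CB finite_subset by blast+
  have inj: "inj_on (\<lambda>r. r + d) C" by (auto simp: inj_on_def)
  have cardB: "card B = R ^ card I" using card_cube [OF I, of 0 "int R"] by (simp add: B_def)
  have cardC': "card C' = card C" unfolding C'_def by (rule card_image [OF inj])
  have "cube I (int D) (int R - int D) \<subseteq> C"
  proof
    fix y assume y: "y \<in> cube I (int D) (int R - int D)"
    have "y \<in> B" unfolding B_def
      using cubeD [OF y] by (intro cubeI) force+
    moreover have "y + d \<in> B" unfolding B_def
    proof (rule cubeI)
      show "0 \<le> (y + d) i \<and> (y + d) i < int R" if "i \<in> I" for i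
        using cubeD(1,2) [OF y that] d(2) [of i] by (auto simp: abs_le_iff)
      show "(y + d) i = 0" if "i \<notin> I" for i
        using cubeD(3) [OF y that] d(1) [OF that] by simp
    qed
    ultimately show "y \<in> C" by (simp add: C_def)
  qed
  then have "card (cube I (int D) (int R - int D)) \<le> card C" using fin by (intro card_mono)
  moreover have "nat (int R - int D - int D) = R - 2 * D" using D by simp
  ultimately have cardC: "(R - 2 * D) ^ card I \<le> card C"
    using card_cube [OF I, of "int D" "int R - int D"] by simp
  have split: "(\<Sum>r\<in>B. h r) = (\<Sum>r\<in>B - K. h r) + (\<Sum>r\<in>K. h r)" if "K \<subseteq> B" for K and h :: "_ \<Rightarrow> complex"
    using sum.subset_diff [OF that finB] by blast
  have "(?p d - 1) * trig_sum I B g \<theta> = (\<Sum>r\<in>B. of_real (g r) * ?p (r + d)) - (\<Sum>r\<in>B. of_real (g r) * ?p r)"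
    by (simp add: trig_sum_def right_diff_distrib left_diff_distrib sum_distrib_left sum_subtractf phase_add mult_ac)
  also have "(\<Sum>r\<in>B. of_real (g r) * ?p (r + d)) =
      (\<Sum>r\<in>B - C. of_real (g r) * ?p (r + d)) + (\<Sum>r\<in>C. of_real (g r) * ?p (r + d))"
    by (rule split [OF CB(1)])
  also have "(\<Sum>r\<in>B. of_real (g r) * ?p r) =
      (\<Sum>r\<in>B - C'. of_real (g r) * ?p r) + (\<Sum>r\<in>C. of_real (g (r + d)) * ?p (r + d))"
    unfolding split [OF CB(2)] by (simp add: C'_def sum.reindex [OF inj])
  also have "(\<Sum>r\<in>B - C. of_real (g r) * ?p (r + d)) + (\<Sum>r\<in>C. of_real (g r) * ?p (r + d)) -
      ((\<Sum>r\<in>B - C'. of_real (g r) * ?p r) + (\<Sum>r\<in>C. of_real (g (r + d)) * ?p (r + d))) =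
      (\<Sum>r\<in>B - C. of_real (g r) * ?p (r + d)) - (\<Sum>r\<in>B - C'. of_real (g r) * ?p r)
      - (\<Sum>r\<in>C. of_real (g (r + d) - g r) * ?p (r + d))"
    by (simp add: left_diff_distrib sum_subtractf)
  finally have eq: "(?p d - 1) * trig_sum I B g \<theta> = \<dots>" .
  have n1: "norm (\<Sum>r\<in>B - C. of_real (g r) * ?p (r + d)) \<le> (\<Sum>r\<in>B - C. 1)"
    using g by (intro sum_norm_le) (simp add: norm_mult)
  have n2: "norm (\<Sum>r\<in>B - C'. of_real (g r) * ?p r) \<le> (\<Sum>r\<in>B - C'. 1)"
    using g by (intro sum_norm_le) (simp add: norm_mult)
  have n3: "norm (\<Sum>r\<in>C. of_real (g (r + d) - g r) * ?p (r + d)) \<le> (\<Sum>r\<in>C. \<epsilon>)"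
    using close CB by (intro sum_norm_le) (auto simp: norm_mult B_def simp flip: of_real_diff)
  have "norm (?p d - 1) * norm (trig_sum I B g \<theta>) \<le>
      real (card (B - C)) + real (card (B - C')) + \<epsilon> * real (card C)"
    unfolding norm_mult [symmetric] eq
    using norm_triangle_ineq4 [of "(\<Sum>r\<in>B - C. of_real (g r) * ?p (r + d)) - (\<Sum>r\<in>B - C'. of_real (g r) * ?p r)"
        "\<Sum>r\<in>C. of_real (g (r + d) - g r) * ?p (r + d)"]
      norm_triangle_ineq4 [of "\<Sum>r\<in>B - C. of_real (g r) * ?p (r + d)" "\<Sum>r\<in>B - C'. of_real (g r) * ?p r"] n1 n2 n3
    by (simp add: mult.commute)
  also have "real (card (B - C)) = real (card B) - real (card C)"
    using CB fin card_mono [OF finB CB(1)] by (simp add: card_Diff_subset of_nat_diff)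
  also have "real (card (B - C')) = real (card B) - real (card C)"
    using CB fin cardC' card_mono [OF finB CB(2)] by (simp add: card_Diff_subset of_nat_diff)
  also have "\<epsilon> * real (card C) \<le> \<epsilon> * real (card B)"
    using card_mono [OF finB CB(1)] \<open>\<epsilon> \<ge> 0\<close> by (intro mult_left_mono) auto
  finally have "norm (?p d - 1) * norm (trig_sum I B g \<theta>) \<le> \<epsilon> * real (card B) + 2 * (real (card B) - real (card C))"
    by simp
  also have "\<dots> \<le> \<epsilon> * real (card B) + 2 * (real (card B) - real ((R - 2 * D) ^ card I))"
    using cardC by (intro add_left_mono mult_left_mono diff_left_mono of_nat_mono) auto
  finally show ?thesis by (simp add: B_def [symmetric] cardB)
qed


section \<open>Unit complex numbers with powers close to one\<close>

text \<open>Since \<open>z\<^sup>2 - 1 = (z - 1) * (z + 1)\<close> and a unit \<open>z\<close> within distance \<open>1\<close> of \<open>1\<close> satisfies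
  \<open>norm (z + 1) \<ge> 3 / 2\<close>, each squaring that stays close to \<open>1\<close> improves the bound by the
  factor \<open>2 / 3\<close>.\<close>

lemma unit_complex_powers_close_imp_close:
  fixes z :: complex
  assumes "norm z = 1" and "\<And>j. j \<le> n \<Longrightarrow> norm (z ^ (2 ^ j) - 1) \<le> 1"
  shows "norm (z - 1) \<le> (2 / 3) ^ n"
  using assms
proof (induction n arbitrary: z)
  case 0
  then show ?case using "0.prems"(2) [of 0] by simp
next
  case (Suc n)
  have "norm ((z\<^sup>2) ^ (2 ^ j) - 1) \<le> 1" if "j \<le> n" for j
    using Suc.prems(2) [of "Suc j"] that by (simp flip: power_mult)
  with Suc have IH: "norm (z\<^sup>2 - 1) \<le> (2 / 3) ^ n" by (simp add: norm_power)
  have n1: "(Re z)\<^sup>2 + (Im z)\<^sup>2 = 1"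
    using Suc.prems(1) by (simp add: cmod_def)
  have "norm (z - 1) \<le> 1" using Suc.prems(2) [of 0] by simp
  then have "(norm (z - 1))\<^sup>2 \<le> 1" by (simp add: power_le_one)
  then have "(Re z - 1)\<^sup>2 + (Im z)\<^sup>2 \<le> 1" by (simp add: cmod_power2)
  with n1 have "Re z \<ge> 1 / 2" by (simp add: power2_eq_square algebra_simps)
  then have "norm (z + 1) \<ge> 3 / 2" using complex_Re_le_cmod [of "z + 1"] by simp
  then have "norm (z - 1) * (3 / 2) \<le> norm (z - 1) * norm (z + 1)"
    by (intro mult_left_mono) auto
  also have "\<dots> = norm (z\<^sup>2 - 1)"
    by (simp add: power2_eq_square algebra_simps flip: norm_mult)
  finally show ?case using IH by simp
qed

lemma unit_complex_all_powers_close_imp_one: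
  fixes z :: complex
  assumes "norm z = 1" and "\<And>n. norm (z ^ n - 1) \<le> 1"
  shows "z = 1"
proof -
  have "norm (z - 1) \<le> (2 / 3) ^ n" for n
    using unit_complex_powers_close_imp_close assms by blast
  moreover have "(\<lambda>n. (2 / 3 :: real) ^ n) \<longlonglongrightarrow> 0" by (simp add: LIMSEQ_power_zero)
  ultimately have "norm (z - 1) \<le> 0" by (meson LIMSEQ_le_const)
  then show ?thesis by simp
qed


section \<open>Words in an abelian group and approximate characters\<close>

text \<open>The canonical homomorphism from the free abelian group on the elements of \<open>G\<close> to \<open>G\<close>.
  It is taken over the support, so that no ambient finite set has to be fixed.\<close>

definition word_map :: "('a, 'm) monoid_scheme \<Rightarrow> ('a \<Rightarrow> int) \<Rightarrow> 'a" where
  "word_map G d = finprod G (\<lambda>g. g [^]\<^bsub>G\<^esub> d g) {g. d g \<noteq> 0}"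

context comm_group
begin

lemma word_map_superset:
  assumes "finite I" "I \<subseteq> carrier G" "\<And>i. i \<notin> I \<Longrightarrow> d i = 0"
  shows "word_map G d = finprod G (\<lambda>g. g [^] d g) I"
  unfolding word_map_def using assms
  by (intro finprod_mono_neutral_cong_left) (auto intro!: int_pow_closed)

lemma word_map_closed [intro]:
  assumes "finite I" "I \<subseteq> carrier G" "\<And>i. i \<notin> I \<Longrightarrow> d i = 0"
  shows "word_map G d \<in> carrier G"
proof -
  have "finprod G (\<lambda>g. g [^] d g) I \<in> carrier G"
    using assms by (intro finprod_closed) (auto intro!: int_pow_closed)
  then show ?thesis using word_map_superset [of I d] assms by simp
qed

lemma word_map_add:
  assumes "finite I" "I \<subseteq> carrier G" "\<And>i. i \<notin> I \<Longrightarrow> c i = 0" "\<And>i. i \<notin> I \<Longrightarrow> d i = 0"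
  shows "word_map G (c + d) = word_map G c \<otimes> word_map G d"
proof -
  have "word_map G (c + d) = finprod G (\<lambda>g. g [^] (c + d) g) I"
    using assms by (intro word_map_superset) auto
  also have "\<dots> = finprod G (\<lambda>g. g [^] c g \<otimes> g [^] d g) I"
    using assms by (intro finprod_cong') (auto simp: int_pow_mult)
  also have "\<dots> = word_map G c \<otimes> word_map G d"
    using assms by (subst finprod_multf) (auto simp: word_map_superset)
  finally show ?thesis .
qed

lemma word_map_unit_vec:
  assumes "x \<in> carrier G"
  shows "word_map G (unit_vec x) = x"
proof -
  have "word_map G (unit_vec x) = finprod G (\<lambda>g. g [^] unit_vec x g) {x}"
    using assms by (intro word_map_superset) (auto simp: unit_vec_def)
  also have "\<dots> = x" using assms by (simp add: unit_vec_def)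
  finally show ?thesis .
qed

end

text \<open>A function adapted to a small set \<open>V\<close> and varying slowly in the directions \<open>W\<close>. The tolerance
  \<open>1 / (8 * N\<^sup>2)\<close> is half of the lower bound \<open>1 / (4 * N\<^sup>2)\<close> for the normalised Fourier coefficient in
  \<open>large_frequency\<close>; the other half is left for boundary terms.\<close>

locale bump = comm_group G for G :: "('a, 'm) monoid_scheme" (structure) +
  fixes V W :: "'a set" and f :: "'a \<Rightarrow> real" and \<C> :: "'a set set" and N :: nat
  assumes cover_finite: "finite \<C>" and cover: "\<Union>\<C> = carrier G" and N: "card \<C> \<le> N" "N > 0"
    and cover_small: "\<And>C x y. C \<in> \<C> \<Longrightarrow> x \<in> C \<Longrightarrow> y \<in> C \<Longrightarrow> inv x \<otimes> y \<in> V"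
    and f_range: "\<And>x. 0 \<le> f x" "\<And>x. f x \<le> 1" and f_one: "\<And>x. x \<in> V \<Longrightarrow> f x = 1"
    and f_slow: "\<And>x w. x \<in> carrier G \<Longrightarrow> w \<in> W \<Longrightarrow> \<bar>f (x \<otimes> w) - f x\<bar> \<le> 1 / (8 * real N ^ 2)"
begin

lemma pigeonhole_translate:
  assumes "finite B" "B \<noteq> {}" "\<And>y. y \<in> B \<Longrightarrow> p y \<in> carrier G"
  obtains t where "t \<in> carrier G" "card B \<le> N * card {y \<in> B. inv t \<otimes> p y \<in> V}"
proof -
  have "\<exists>C\<in>\<C>. card B \<le> N * card {y \<in> B. p y \<in> C}"
  proof (rule ccontr)
    assume "\<not> ?thesis"
    then have small: "N * card {y \<in> B. p y \<in> C} < card B" if "C \<in> \<C>" for C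
      using that by (meson not_le)
    have "B = (\<Union>C\<in>\<C>. {y \<in> B. p y \<in> C})" using assms(3) cover by auto
    then have "card B \<le> (\<Sum>C\<in>\<C>. card {y \<in> B. p y \<in> C})"
      using card_UN_le [OF cover_finite, of "\<lambda>C. {y \<in> B. p y \<in> C}"] by simp
    then have "N * card B \<le> (\<Sum>C\<in>\<C>. N * card {y \<in> B. p y \<in> C})"
      by (simp flip: sum_distrib_left)
    also have "\<dots> < (\<Sum>C\<in>\<C>. card B)"
    proof (rule sum_strict_mono)
      obtain y where "y \<in> B" using assms(2) by blast
      then have "p y \<in> \<Union>\<C>" using assms(3) cover by simp
      then show "\<C> \<noteq> {}" by auto
    qed (use small cover_finite in auto)
    also have "\<dots> \<le> N * card B" using N by simp
    finally show False by simp
  qed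
  then obtain C where C: "C \<in> \<C>" "card B \<le> N * card {y \<in> B. p y \<in> C}" by blast
  moreover have "card B > 0" using assms by (simp add: card_gt_0_iff)
  ultimately have "{y \<in> B. p y \<in> C} \<noteq> {}" by (metis card.empty mult_0_right not_le)
  then obtain z where z: "z \<in> B" "p z \<in> C" by blast
  have "card {y \<in> B. p y \<in> C} \<le> card {y \<in> B. inv (p z) \<otimes> p y \<in> V}"
    using C z cover_small assms(1) by (intro card_mono) auto
  then have "N * card {y \<in> B. p y \<in> C} \<le> N * card {y \<in> B. inv (p z) \<otimes> p y \<in> V}" by simp
  with C have "card B \<le> N * card {y \<in> B. inv (p z) \<otimes> p y \<in> V}" by linarith
  then show thesis using that assms(3) [OF z(1)] by blast
qed

text \<open>The pullbacks of \<open>V\<close> and \<open>f\<close> along \<open>word_map\<close> may be translated freely, because the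
  hypothesis of \<open>large_frequency\<close> only involves differences; pigeonhole translates give both sets density at
  least \<open>1 / N\<close>. The box length \<open>R\<close> is chosen first, so large that boundary effects of
  the vectors in \<open>\<D>\<close> are negligible, and then \<open>Q\<close> so large that \<open>R\<close> is negligible against it.\<close>

lemma approximate_character:
  assumes I: "finite I" "I \<subseteq> carrier G" "x0 \<in> I"
    and far: "\<And>a a' b b'. a \<in> V \<Longrightarrow> a' \<in> V \<Longrightarrow> b \<in> carrier G \<Longrightarrow> b' \<in> carrier G \<Longrightarrow>
        f b \<noteq> 0 \<Longrightarrow> f b' \<noteq> 0 \<Longrightarrow> a \<otimes> b \<otimes> x0 \<noteq> a' \<otimes> b'"
    and V: "V \<subseteq> carrier G"
    and D: "finite \<D>" "\<And>d i. d \<in> \<D> \<Longrightarrow> i \<notin> I \<Longrightarrow> d i = 0" "\<And>d. d \<in> \<D> \<Longrightarrow> word_map G d \<in> W"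
  obtains \<theta> where "\<And>i. \<theta> i \<in> {0..2 * pi}"
    and "\<And>d. d \<in> \<D> \<Longrightarrow> norm (phase I \<theta> d - 1) \<le> 1"
    and "1 / (8 * real N ^ 4) \<le> 1 - cos (\<theta> x0)"
proof -
  define k where "k = card I"
  obtain D' where D': "\<And>d i. d \<in> \<D> \<Longrightarrow> \<bar>d i\<bar> \<le> int D'"
  proof -
    have fin: "finite ((\<lambda>(d, i). nat \<bar>d i\<bar>) ` (\<D> \<times> I))" using D(1) I(1) by simp
    have "\<bar>d i\<bar> \<le> int (Max (insert 0 ((\<lambda>(d, i). nat \<bar>d i\<bar>) ` (\<D> \<times> I))))" if "d \<in> \<D>" for d i
    proof (cases "i \<in> I")
      case True
      then have "nat \<bar>d i\<bar> \<le> Max (insert 0 ((\<lambda>(d, i). nat \<bar>d i\<bar>) ` (\<D> \<times> I)))"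
        using that fin by (intro Max_ge) (auto intro!: image_eqI [of _ _ "(d, i)"])
      then show ?thesis by linarith
    next
      case False
      then show ?thesis using D(2) [OF that False] by simp
    qed
    then show thesis using that by blast
  qed
  have "(\<lambda>R. (1 - real (2 * D') / real R) ^ k) \<longlonglongrightarrow> (1 - 0) ^ k"
    by (intro tendsto_intros lim_const_over_n)
  then have "eventually (\<lambda>R. (1 - real (2 * D') / real R) ^ k > 1 - 1 / (16 * real N ^ 2)) sequentially"
    using N by (intro order_tendstoD) auto
  then have "eventually (\<lambda>R. (1 - real (2 * D') / real R) ^ k > 1 - 1 / (16 * real N ^ 2) \<and> R \<ge> 2 * D' + 1) sequentially"
    using eventually_ge_at_top eventually_conj by blast
  then obtain R where R: "(1 - real (2 * D') / real R) ^ k > 1 - 1 / (16 * real N ^ 2)" "R \<ge> 2 * D' + 1"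
    using eventually_happens' sequentially_bot by blast
  have Rpos: "R > 0" using R(2) by simp
  have "1 - real (2 * D') / real R = real (R - 2 * D') / real R"
    using R(2) by (simp add: of_nat_diff field_simps)
  then have "real (R - 2 * D') ^ k / real R ^ k > 1 - 1 / (16 * real N ^ 2)"
    using R(1) by (simp add: power_divide)
  then have R2: "2 * (real R ^ k - real (R - 2 * D') ^ k) \<le> real R ^ k / (8 * real N ^ 2)"
    using Rpos N by (simp add: field_simps)
  have "(\<lambda>Q. (1 + real R / real Q) ^ k) \<longlonglongrightarrow> (1 + 0) ^ k"
    by (intro tendsto_intros lim_const_over_n)
  then have "eventually (\<lambda>Q. (1 + real R / real Q) ^ k < 2) sequentially"
    by (intro order_tendstoD) auto
  then have "eventually (\<lambda>Q. (1 + real R / real Q) ^ k < 2 \<and> Q \<ge> 1) sequentially"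
    using eventually_ge_at_top eventually_conj by blast
  then obtain Q where Q: "(1 + real R / real Q) ^ k < 2" "Q \<ge> 1"
    using eventually_happens' sequentially_bot by blast
  have "1 + real R / real Q = real (Q + R) / real Q" using Q(2) by (simp add: field_simps)
  then have QR: "real (Q + R) ^ k \<le> 2 * real Q ^ k"
    using Q by (simp add: power_divide field_simps)
  let ?p = "word_map G"
  have supp: "i \<notin> I \<Longrightarrow> y i = 0" if "y \<in> cube I 0 h" for y i h
    using cubeD that by metis
  have p_closed: "?p y \<in> carrier G" if "y \<in> cube I 0 h" for y h
    using I supp [OF that] by (intro word_map_closed) auto
  have cube_ne: "cube I 0 (int h) \<noteq> {}" "card (cube I 0 (int h)) = h ^ k" if "h > 0" for h
    using card_cube [OF I(1), of 0 "int h"] that by (auto simp: k_def)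
  obtain t where t: "t \<in> carrier G" "card (cube I 0 (int Q)) \<le> N * card {y \<in> cube I 0 (int Q). inv t \<otimes> ?p y \<in> V}"
    using pigeonhole_translate [of "cube I 0 (int Q)" ?p] finite_cube [OF I(1)] cube_ne Q p_closed by force
  obtain s where s: "s \<in> carrier G" "card (cube I 0 (int R)) \<le> N * card {y \<in> cube I 0 (int R). inv s \<otimes> ?p y \<in> V}"
    using pigeonhole_translate [of "cube I 0 (int R)" ?p] finite_cube [OF I(1)] cube_ne Rpos p_closed by force
  define A where "A = {y \<in> cube I 0 (int Q). inv t \<otimes> ?p y \<in> V}"
  define g where "g y = f (inv s \<otimes> ?p y)" for y
  obtain \<theta> where \<theta>: "\<And>i. \<theta> i \<in> {0..2 * pi}"
    "real R ^ card I / (4 * real N ^ 2) \<le> norm (trig_sum I (cube I 0 (int R)) g \<theta>)"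
    "1 / (8 * real N ^ 4) \<le> 1 - cos (\<theta> x0)"
  proof (rule large_frequency [of I x0 N Q R A g])
    show "real Q ^ card I \<le> real N * card A"
      using t(2) cube_ne(2) [of Q] Q by (simp add: A_def k_def flip: of_nat_power of_nat_mult)
    have "real (card {y \<in> cube I 0 (int R). inv s \<otimes> ?p y \<in> V}) = (\<Sum>y\<in>{y \<in> cube I 0 (int R). inv s \<otimes> ?p y \<in> V}. g y)"
      using f_one by (simp add: g_def)
    also have "\<dots> \<le> (\<Sum>y\<in>cube I 0 (int R). g y)"
      using f_range by (intro sum_mono2 finite_cube I) (auto simp: g_def)
    finally have "real N * real (card {y \<in> cube I 0 (int R). inv s \<otimes> ?p y \<in> V}) \<le> real N * (\<Sum>y\<in>cube I 0 (int R). g y)"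
      by (intro mult_left_mono) auto
    moreover have "real R ^ card I \<le> real N * real (card {y \<in> cube I 0 (int R). inv s \<otimes> ?p y \<in> V})"
      using s(2) cube_ne(2) [of R] Rpos by (simp add: k_def flip: of_nat_power of_nat_mult)
    ultimately show "real R ^ card I \<le> real N * (\<Sum>y\<in>cube I 0 (int R). g y)" by linarith
    show "y + r + unit_vec x0 \<noteq> y' + r'" if "y \<in> A" "y' \<in> A" "r \<in> cube I 0 (int R)" "r' \<in> cube I 0 (int R)"
        "g r \<noteq> 0" "g r' \<noteq> 0" for y y' r r'
    proof
      assume eq: "y + r + unit_vec x0 = y' + r'"
      have y: "y \<in> cube I 0 (int Q)" "y' \<in> cube I 0 (int Q)" using that by (auto simp: A_def)
      note sup = supp [OF y(1)] supp [OF y(2)] supp [OF that(3)] supp [OF that(4)]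
      have "?p (y + r + unit_vec x0) = ?p y \<otimes> ?p r \<otimes> x0"
        using sup I word_map_unit_vec [of x0]
        by (subst word_map_add [of I]; auto simp: unit_vec_def word_map_add [of I])
      moreover have "?p (y' + r') = ?p y' \<otimes> ?p r'"
        using sup I by (intro word_map_add) auto
      ultimately have e: "?p y \<otimes> ?p r \<otimes> x0 = ?p y' \<otimes> ?p r'" using eq by simp
      have cl: "?p y \<in> carrier G" "?p y' \<in> carrier G" "?p r \<in> carrier G" "?p r' \<in> carrier G" "x0 \<in> carrier G"
        using p_closed y that I by auto
      have "(inv t \<otimes> ?p y) \<otimes> (inv s \<otimes> ?p r) \<otimes> x0 = inv t \<otimes> inv s \<otimes> (?p y \<otimes> ?p r \<otimes> x0)"
        using cl s t by (simp add: m_ac)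
      also have "\<dots> = (inv t \<otimes> ?p y') \<otimes> (inv s \<otimes> ?p r')"
        unfolding e using cl s t by (simp add: m_ac)
      finally show False
        using far [of "inv t \<otimes> ?p y" "inv t \<otimes> ?p y'" "inv s \<otimes> ?p r" "inv s \<otimes> ?p r'"] that cl s t
        by (auto simp: A_def g_def)
    qed
  qed (use I N Q Rpos QR f_range in \<open>auto simp: A_def g_def k_def\<close>)
  show thesis
  proof (rule that [of \<theta>])
    fix d assume d: "d \<in> \<D>"
    have "norm (phase I \<theta> d - 1) * norm (trig_sum I (cube I 0 (int R)) g \<theta>) \<le>
        1 / (8 * real N ^ 2) * real R ^ card I + 2 * (real R ^ card I - real (R - 2 * D') ^ card I)"
    proof (rule trig_sum_shift)
      fix r assume r: "r \<in> cube I 0 (int R)"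
      have "?p (r + d) = ?p r \<otimes> ?p d"
        using I supp [OF r] D(2) [OF d] by (intro word_map_add) auto
      moreover have "?p d \<in> carrier G" using I D(2) [OF d] by (intro word_map_closed) auto
      ultimately have "g (r + d) = f (inv s \<otimes> ?p r \<otimes> ?p d)"
        using s p_closed [OF r] by (simp add: g_def m_assoc)
      then show "\<bar>g (r + d) - g r\<bar> \<le> 1 / (8 * real N ^ 2)"
        using f_slow [of "inv s \<otimes> ?p r" "?p d"] s p_closed [OF r] D(3) [OF d] by (simp add: g_def)
    qed (use I D(2) [OF d] D' [OF d] R(2) f_range in \<open>auto simp: g_def\<close>)
    also have "\<dots> \<le> 1 / (8 * real N ^ 2) * real R ^ k + real R ^ k / (8 * real N ^ 2)"
      using R2 by (simp add: k_def)
    also have "\<dots> = real R ^ k / (4 * real N ^ 2)" by simp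
    finally have "norm (phase I \<theta> d - 1) * norm (trig_sum I (cube I 0 (int R)) g \<theta>) \<le> real R ^ k / (4 * real N ^ 2)" .
    moreover have "norm (phase I \<theta> d - 1) * (real R ^ k / (4 * real N ^ 2)) \<le>
        norm (phase I \<theta> d - 1) * norm (trig_sum I (cube I 0 (int R)) g \<theta>)"
      using \<theta>(2) by (intro mult_left_mono) (auto simp: k_def)
    ultimately have "norm (phase I \<theta> d - 1) * (real R ^ k / (4 * real N ^ 2)) \<le> 1 * (real R ^ k / (4 * real N ^ 2))"
      by simp
    moreover have "real R ^ k / (4 * real N ^ 2) > 0" using Rpos N by simp
    ultimately show "norm (phase I \<theta> d - 1) \<le> 1" by (simp only: mult_le_cancel_right_pos)
  qed (use \<theta> in auto)
qed

end

section \<open>Totally bounded group topologies and characters\<close>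

text \<open>A set is large in this sense if the group is a finite union of sets whose differences all lie in
  it. Unlike covering by finitely many translates of \<open>D\<close>, this is visibly stable under intersections
  (common refinement) and under passing to subgroups (trace of the cover).\<close>

definition small_cover :: "('a, 'm) monoid_scheme \<Rightarrow> 'a set \<Rightarrow> bool" where
  "small_cover G D \<longleftrightarrow>
     (\<exists>\<C>. finite \<C> \<and> \<Union>\<C> = carrier G \<and> (\<forall>C\<in>\<C>. \<forall>x\<in>C. \<forall>y\<in>C. inv\<^bsub>G\<^esub> x \<otimes>\<^bsub>G\<^esub> y \<in> D))"

definition totally_bounded_group_topology :: "('a, 'm) monoid_scheme \<Rightarrow> 'a topology \<Rightarrow> bool" where
  "totally_bounded_group_topology G T \<longleftrightarrow>
     group_topology G T \<and> (\<forall>U. openin T U \<longrightarrow> \<one>\<^bsub>G\<^esub> \<in> U \<longrightarrow> small_cover G U)"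

definition character :: "('a, 'm) monoid_scheme \<Rightarrow> ('a \<Rightarrow> complex) \<Rightarrow> bool" where
  "character G \<phi> \<longleftrightarrow> (\<forall>x\<in>carrier G. norm (\<phi> x) = 1) \<and>
     (\<forall>x\<in>carrier G. \<forall>y\<in>carrier G. \<phi> (x \<otimes>\<^bsub>G\<^esub> y) = \<phi> x * \<phi> y)"

definition continuous_character ::
    "('a, 'm) monoid_scheme \<Rightarrow> 'a topology \<Rightarrow> ('a \<Rightarrow> complex) \<Rightarrow> bool" where
  "continuous_character G T \<phi> \<longleftrightarrow> character G \<phi> \<and>
     (\<forall>\<epsilon>>0. \<exists>W. openin T W \<and> \<one>\<^bsub>G\<^esub> \<in> W \<and> (\<forall>w\<in>W. norm (\<phi> w - 1) < \<epsilon>))"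

fun set_power :: "('a, 'm) monoid_scheme \<Rightarrow> 'a set \<Rightarrow> nat \<Rightarrow> 'a set" where
  "set_power G W 0 = {\<one>\<^bsub>G\<^esub>}"
| "set_power G W (Suc j) = set_power G W j <#>\<^bsub>G\<^esub> W"

lemma small_coverE:
  assumes "small_cover G D"
  obtains \<C> where "finite \<C>" "\<Union>\<C> = carrier G"
    "\<forall>C\<in>\<C>. \<forall>x\<in>C. \<forall>y\<in>C. inv\<^bsub>G\<^esub> x \<otimes>\<^bsub>G\<^esub> y \<in> D"
  using assms that unfolding small_cover_def by blast

lemma small_cover_mono:
  assumes "small_cover G D" "D \<subseteq> E"
  shows "small_cover G E"
proof -
  obtain \<C> where C: "finite \<C>" "\<Union>\<C> = carrier G" "\<forall>C\<in>\<C>. \<forall>x\<in>C. \<forall>y\<in>C. inv\<^bsub>G\<^esub> x \<otimes>\<^bsub>G\<^esub> y \<in> D"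
    using assms(1) unfolding small_cover_def by blast
  have "\<forall>C\<in>\<C>. \<forall>x\<in>C. \<forall>y\<in>C. inv\<^bsub>G\<^esub> x \<otimes>\<^bsub>G\<^esub> y \<in> E"
    using C(3) assms(2) by (simp add: subset_iff)
  with C(1,2) show ?thesis unfolding small_cover_def by (intro exI [of _ \<C>] conjI)
qed

lemma small_cover_Int:
  assumes "small_cover G D" "small_cover G E"
  shows "small_cover G (D \<inter> E)"
proof -
  obtain \<C> where C: "finite \<C>" "\<Union>\<C> = carrier G" "\<forall>C\<in>\<C>. \<forall>x\<in>C. \<forall>y\<in>C. inv\<^bsub>G\<^esub> x \<otimes>\<^bsub>G\<^esub> y \<in> D"
    using assms(1) unfolding small_cover_def by blast
  obtain \<C>' where C': "finite \<C>'" "\<Union>\<C>' = carrier G" "\<forall>C\<in>\<C>'. \<forall>x\<in>C. \<forall>y\<in>C. inv\<^bsub>G\<^esub> x \<otimes>\<^bsub>G\<^esub> y \<in> E"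
    using assms(2) unfolding small_cover_def by blast
  define \<K> where "\<K> = (\<lambda>(A, B). A \<inter> B) ` (\<C> \<times> \<C>')"
  have "finite \<K>" using C C' by (simp add: \<K>_def)
  moreover have "\<Union>\<K> = \<Union>\<C> \<inter> \<Union>\<C>'" by (auto simp: \<K>_def)
  moreover have "\<forall>C\<in>\<K>. \<forall>x\<in>C. \<forall>y\<in>C. inv\<^bsub>G\<^esub> x \<otimes>\<^bsub>G\<^esub> y \<in> D \<inter> E"
    using C(3) C'(3) by (auto simp: \<K>_def)
  ultimately show ?thesis unfolding small_cover_def using C(2) C'(2) by (metis Int_absorb)
qed

context group
begin

lemma group_topology_halving:
  assumes T: "group_topology G T" and U: "openin T U" "\<one> \<in> U"
  obtains V where "openin T V" "\<one> \<in> V" "V \<subseteq> U" "\<And>x y. x \<in> V \<Longrightarrow> y \<in> V \<Longrightarrow> x \<otimes> y \<in> U"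
    "\<And>x. x \<in> V \<Longrightarrow> inv x \<in> V"
proof -
  have top: "topspace T = carrier G" using T by (simp add: group_topology_def)
  define P where "P = {p \<in> topspace (prod_topology T T). (\<lambda>(x, y). x \<otimes> y) p \<in> U}"
  have "openin (prod_topology T T) P" unfolding P_def
    using T U by (intro openin_continuous_map_preimage) (auto simp: group_topology_def)
  moreover have "(\<one>, \<one>) \<in> P"
    using U top by (simp add: P_def)
  ultimately obtain A B where AB: "openin T A" "openin T B" "\<one> \<in> A" "\<one> \<in> B"
      "A \<times> B \<subseteq> P"
    using openin_prod_topology_alt [of T T P] by blast
  define V0 where "V0 = A \<inter> B"
  define V where "V = V0 \<inter> {x \<in> topspace T. inv x \<in> V0}"
  have V0: "openin T V0" using AB by (auto simp: V0_def)
  have sub: "V0 \<subseteq> carrier G" using openin_subset [OF V0] top by simp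
  show thesis
  proof
    show "openin T V" unfolding V_def
      using T V0 by (intro openin_Int openin_continuous_map_preimage) (auto simp: group_topology_def)
    show "\<one> \<in> V" using AB top by (simp add: V_def V0_def)
    show xy: "x \<otimes> y \<in> U" if "x \<in> V" "y \<in> V" for x y
      using AB(5) that by (auto simp: V_def V0_def P_def)
    show "V \<subseteq> U"
    proof
      fix x assume x: "x \<in> V"
      then have "x \<in> carrier G" using sub by (auto simp: V_def)
      then show "x \<in> U" using xy [OF x \<open>\<one> \<in> V\<close>] by simp
    qed
    show "inv x \<in> V" if "x \<in> V" for x
      using that sub top by (auto simp: V_def)
  qed
qed

lemma set_power_mono: "W \<subseteq> W' \<Longrightarrow> set_power G W j \<subseteq> set_power G W' j"
  by (induction j) (auto simp: set_mult_def)

lemma pow_mem_set_power: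
  assumes "w \<in> W" "W \<subseteq> carrier G"
  shows "w [^] (j::nat) \<in> set_power G W j"
  using assms by (induction j) (auto simp: set_mult_def)

text \<open>Repeated halving: if all powers of \<open>W\<close> up to \<open>J\<close> lie in a half \<open>V\<close> of \<open>U\<close>, then
  those of \<open>W \<inter> V\<close> up to \<open>Suc J\<close> lie in \<open>V <#> V\<close>.\<close>

lemma small_powers_neighbourhood:
  assumes T: "group_topology G T" and U: "openin T U" "\<one> \<in> U"
  obtains W where "openin T W" "\<one> \<in> W" "\<And>w. w \<in> W \<Longrightarrow> inv w \<in> W" "\<And>j. j \<le> J \<Longrightarrow> set_power G W j \<subseteq> U"
proof -
  have "\<exists>W. openin T W \<and> \<one> \<in> W \<and> (\<forall>w\<in>W. inv w \<in> W) \<and> (\<forall>j\<le>J. set_power G W j \<subseteq> U)"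
    using U
  proof (induction J arbitrary: U)
    case 0
    then obtain V where "openin T V" "\<one> \<in> V" "V \<subseteq> U" "\<And>x. x \<in> V \<Longrightarrow> inv x \<in> V"
      using group_topology_halving [OF T] by metis
    then show ?case using 0 by (intro exI [of _ V]) auto
  next
    case (Suc J)
    then obtain V where V: "openin T V" "\<one> \<in> V" "V \<subseteq> U" "\<And>x y. x \<in> V \<Longrightarrow> y \<in> V \<Longrightarrow> x \<otimes> y \<in> U"
      "\<And>x. x \<in> V \<Longrightarrow> inv x \<in> V"
      using group_topology_halving [OF T] by metis
    obtain W where W: "openin T W" "\<one> \<in> W" "\<forall>w\<in>W. inv w \<in> W" "\<forall>j\<le>J. set_power G W j \<subseteq> V"
      using Suc.IH [OF V(1,2)] by blast
    have le: "set_power G (W \<inter> V) j \<subseteq> V" if "j \<le> J" for j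
      using W(4) that set_power_mono [of "W \<inter> V" W j] by blast
    have "set_power G (W \<inter> V) j \<subseteq> U" if "j \<le> Suc J" for j
    proof (cases "j \<le> J")
      case True
      then show ?thesis using le V(3) by blast
    next
      case False
      then have "j = Suc J" using that by simp
      then show ?thesis using le [of J] V(4) by (auto simp: set_mult_def)
    qed
    then show ?case using V W by (intro exI [of _ "W \<inter> V"]) auto
  qed
  then show thesis using that by blast
qed

text \<open>A translate of \<open>V\<close> has all its differences in \<open>inv V <#> V\<close>; conversely, choosing one point from
  each member of a small cover gives the centres of translates that cover.\<close>

lemma precompact_iff_totally_bounded:
  "precompact_group_topology G T \<longleftrightarrow> totally_bounded_group_topology G T \<and> Hausdorff_space T"
proof (intro iffI conjI)
  assume T: "precompact_group_topology G T"
  then show "Hausdorff_space T" by (simp add: precompact_group_topology_def)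
  have gt: "group_topology G T" using T by (simp add: precompact_group_topology_def)
  have top: "topspace T = carrier G" using gt by (simp add: group_topology_def)
  have "small_cover G U" if U: "openin T U" "\<one> \<in> U" for U
  proof -
    obtain V where V: "openin T V" "\<one> \<in> V" "V \<subseteq> U" "\<And>x y. x \<in> V \<Longrightarrow> y \<in> V \<Longrightarrow> x \<otimes> y \<in> U"
      "\<And>x. x \<in> V \<Longrightarrow> inv x \<in> V"
      using group_topology_halving [OF gt U] by metis
    have VG: "V \<subseteq> carrier G" using openin_subset [OF V(1)] top by simp
    moreover have "T interior_of V = V" using V(1) by (simp add: interior_of_openin)
    ultimately obtain F where F: "finite F" "F \<subseteq> carrier G" "F <#> V = carrier G"
      using T V(2) unfolding precompact_group_topology_def by metis
    have diff: "inv x \<otimes> y \<in> U" if xy: "f \<in> F" "x \<in> {f \<otimes> v |v. v \<in> V}" "y \<in> {f \<otimes> v |v. v \<in> V}" for f x y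
    proof -
      obtain v w where vw: "v \<in> V" "w \<in> V" "x = f \<otimes> v" "y = f \<otimes> w" using xy by blast
      have cl: "f \<in> carrier G" "v \<in> carrier G" "w \<in> carrier G" using vw VG F that by auto
      have "inv x \<otimes> y = inv v \<otimes> (inv f \<otimes> (f \<otimes> w))"
        using cl vw by (simp add: inv_mult_group m_assoc)
      also have "\<dots> = inv v \<otimes> w" using cl by (simp flip: m_assoc)
      finally show ?thesis using V(4) [OF V(5) [OF vw(1)] vw(2)] by simp
    qed
    show ?thesis unfolding small_cover_def
    proof (intro exI conjI)
      show "finite ((\<lambda>f. {f \<otimes> v |v. v \<in> V}) ` F)" using F by simp
      show "\<Union>((\<lambda>f. {f \<otimes> v |v. v \<in> V}) ` F) = carrier G"
        unfolding F(3) [symmetric] by (auto simp: set_mult_def)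
    qed (use diff in blast)
  qed
  then show "totally_bounded_group_topology G T"
    using gt by (simp add: totally_bounded_group_topology_def)
next
  assume T: "totally_bounded_group_topology G T \<and> Hausdorff_space T"
  then have gt: "group_topology G T" by (simp add: totally_bounded_group_topology_def)
  have "\<exists>F. finite F \<and> F \<subseteq> carrier G \<and> F <#> U = carrier G"
    if U: "U \<subseteq> carrier G" "\<one> \<in> T interior_of U" for U
  proof -
    have "small_cover G (T interior_of U)"
      using T U by (simp add: totally_bounded_group_topology_def)
    then have "small_cover G U" using interior_of_subset by (rule small_cover_mono)
    then obtain \<C> where C: "finite \<C>" "\<Union>\<C> = carrier G" "\<forall>C\<in>\<C>. \<forall>x\<in>C. \<forall>y\<in>C. inv x \<otimes> y \<in> U"
      by (rule small_coverE)
    define p where "p C = (SOME x. x \<in> C)" for C :: "'a set"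
    have p: "p C \<in> C" if "C \<noteq> {}" for C using that unfolding p_def by (simp add: some_in_eq)
    define F where "F = p ` {C \<in> \<C>. C \<noteq> {}}"
    have FG: "F \<subseteq> carrier G" using p C(2) by (auto simp: F_def)
    have "y \<in> F <#> U" if y: "y \<in> carrier G" for y
    proof -
      obtain D where D: "D \<in> \<C>" "y \<in> D" using C(2) y by blast
      then have pD: "p D \<in> D" "p D \<in> F" using p by (auto simp: F_def)
      then have "inv (p D) \<otimes> y \<in> U" "p D \<in> carrier G" using C(3) D FG by auto
      moreover from this have "y = p D \<otimes> (inv (p D) \<otimes> y)" using y by (simp flip: m_assoc)
      ultimately show ?thesis using pD(2) unfolding set_mult_def by blast
    qed
    moreover have "F <#> U \<subseteq> carrier G" using FG U by (auto simp: set_mult_def)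
    ultimately show ?thesis using FG C(1) by (intro exI [of _ F]) (auto simp: F_def)
  qed
  then show "precompact_group_topology G T"
    using T gt by (simp add: precompact_group_topology_def)
qed

lemma character_one: "character G \<phi> \<Longrightarrow> \<phi> \<one> = 1"
  unfolding character_def by (metis mult_cancel_left1 norm_zero one_closed r_one zero_neq_one)

lemma character_pow:
  assumes "character G \<phi>" "x \<in> carrier G"
  shows "\<phi> (x [^] (n::nat)) = \<phi> x ^ n"
  using assms character_one by (induction n) (auto simp: character_def mult.commute)

lemma character_diff:
  assumes "character G \<phi>" "x \<in> carrier G" "y \<in> carrier G"
  shows "norm (\<phi> (inv x \<otimes> y) - 1) = norm (\<phi> y - \<phi> x)"
proof -
  have "\<phi> x * \<phi> (inv x \<otimes> y) = \<phi> (x \<otimes> (inv x \<otimes> y))"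
    using assms by (simp add: character_def)
  also have "x \<otimes> (inv x \<otimes> y) = y" using assms by (simp flip: m_assoc)
  finally have "\<phi> y - \<phi> x = \<phi> x * (\<phi> (inv x \<otimes> y) - 1)" by (simp add: algebra_simps)
  then show ?thesis using assms by (simp add: norm_mult character_def)
qed

text \<open>A character that is close to \<open>1\<close> on \<open>W\<close> has \<open>\<phi> w\<close>, \<open>(\<phi> w)\<^sup>2\<close>, \<open>(\<phi> w)\<^sup>4\<close>, ... close to \<open>1\<close>
  for all \<open>w\<close> of which sufficiently many powers stay in \<open>W\<close>. So the one crude bound on \<open>W\<close> makes
  a family of characters equicontinuous.\<close>

lemma equicontinuous_characters:
  assumes T: "group_topology G T" and W: "openin T W" "\<one> \<in> W" and "\<epsilon> > 0"
  obtains W' where "openin T W'" "\<one> \<in> W'"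
    "\<And>\<phi> w. character G \<phi> \<Longrightarrow> (\<And>w. w \<in> W \<Longrightarrow> norm (\<phi> w - 1) \<le> 1) \<Longrightarrow> w \<in> W' \<Longrightarrow> norm (\<phi> w - 1) < \<epsilon>"
proof -
  obtain n where n: "(2 / 3 :: real) ^ n < \<epsilon>"
    using real_arch_pow_inv [of \<epsilon> "2 / 3"] \<open>\<epsilon> > 0\<close> by auto
  obtain W' where W': "openin T W'" "\<one> \<in> W'" "\<And>j. j \<le> 2 ^ n \<Longrightarrow> set_power G W' j \<subseteq> W"
    using small_powers_neighbourhood [OF T W] by metis
  have sub: "W' \<subseteq> carrier G" using openin_subset [OF W'(1)] T by (simp add: group_topology_def)
  show thesis
  proof (rule that [OF W'(1,2)])
    fix \<phi> w assume \<phi>: "character G \<phi>" "\<And>w. w \<in> W \<Longrightarrow> norm (\<phi> w - 1) \<le> 1" and w: "w \<in> W'"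
    have "norm (\<phi> w ^ (2 ^ j) - 1) \<le> 1" if "j \<le> n" for j
    proof -
      have "w [^] ((2::nat) ^ j) \<in> set_power G W' (2 ^ j)" using pow_mem_set_power [OF w sub] .
      moreover have "(2::nat) ^ j \<le> 2 ^ n" using that by simp
      ultimately have "w [^] ((2::nat) ^ j) \<in> W" using W'(3) by blast
      then have "norm (\<phi> (w [^] ((2::nat) ^ j)) - 1) \<le> 1" by (rule \<phi>(2))
      moreover have "w \<in> carrier G" using sub w by blast
      ultimately show ?thesis using character_pow [OF \<phi>(1)] by simp
    qed
    moreover have "norm (\<phi> w) = 1" using \<phi>(1) subsetD [OF sub w] by (simp add: character_def)
    ultimately have "norm (\<phi> w - 1) \<le> (2 / 3) ^ n" by (intro unit_complex_powers_close_imp_close)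
    then show "norm (\<phi> w - 1) < \<epsilon>" using n by simp
  qed
qed

end

text \<open>Let \<open>f\<close> count, up to the factor \<open>1 / J\<close>, the indices \<open>j < J\<close> with \<open>x\<close> in \<open>V W\<^sup>j\<close>. Multiplication by
  an element of \<open>W\<close> moves membership from \<open>j\<close> to \<open>j + 1\<close> and so changes the count by at most one.
  The support of \<open>f\<close> lies in \<open>V V\<close> when these \<open>W\<^sup>j\<close> lie in \<open>V\<close>. The final clause keeps every
  product \<open>a' b' (a b)\<inverse>\<close> with \<open>a\<close>, \<open>a'\<close> in \<open>V\<close> and \<open>b\<close>, \<open>b'\<close> in the support of \<open>f\<close> inside \<open>U\<close>; two halvings
  of \<open>U\<close> ahead of \<open>V\<close> provide for this.\<close>

lemma (in comm_group) bump_exists: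
  assumes T: "totally_bounded_group_topology G T" and U: "openin T U" "\<one> \<in> U"
  obtains V W f \<C> N where "bump G V W f \<C> N" "V \<subseteq> carrier G" "openin T W" "\<one> \<in> W"
    "\<And>a a' b b' x. a \<in> V \<Longrightarrow> a' \<in> V \<Longrightarrow> b \<in> carrier G \<Longrightarrow> b' \<in> carrier G \<Longrightarrow> f b \<noteq> 0 \<Longrightarrow> f b' \<noteq> 0 \<Longrightarrow>
        x \<in> carrier G - U \<Longrightarrow> a \<otimes> b \<otimes> x \<noteq> a' \<otimes> b'"
proof -
  have gt: "group_topology G T" using T by (simp add: totally_bounded_group_topology_def)
  have sub: "X \<subseteq> carrier G" if "openin T X" for X
    using openin_subset [OF that] gt by (simp add: group_topology_def)
  obtain V1 where V1: "openin T V1" "\<one> \<in> V1" "V1 \<subseteq> U" "\<And>x y. x \<in> V1 \<Longrightarrow> y \<in> V1 \<Longrightarrow> x \<otimes> y \<in> U"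
      "\<And>x. x \<in> V1 \<Longrightarrow> inv x \<in> V1"
    using group_topology_halving [OF gt U] by metis
  obtain V2 where V2: "openin T V2" "\<one> \<in> V2" "V2 \<subseteq> V1" "\<And>x y. x \<in> V2 \<Longrightarrow> y \<in> V2 \<Longrightarrow> x \<otimes> y \<in> V1"
      "\<And>x. x \<in> V2 \<Longrightarrow> inv x \<in> V2"
    using group_topology_halving [OF gt V1(1,2)] by metis
  obtain V where V: "openin T V" "\<one> \<in> V" "V \<subseteq> V2" "\<And>x y. x \<in> V \<Longrightarrow> y \<in> V \<Longrightarrow> x \<otimes> y \<in> V2"
      "\<And>x. x \<in> V \<Longrightarrow> inv x \<in> V"
    using group_topology_halving [OF gt V2(1,2)] by metis
  have "small_cover G V" using T V by (simp add: totally_bounded_group_topology_def)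
  then obtain \<C> where C: "finite \<C>" "\<Union>\<C> = carrier G" "\<forall>C\<in>\<C>. \<forall>x\<in>C. \<forall>y\<in>C. inv x \<otimes> y \<in> V"
    by (rule small_coverE)
  \<comment> \<open>The successor keeps \<open>N\<close> positive without inspecting the cover.\<close>
  define N where "N = Suc (card \<C>)"
  \<comment> \<open>One step of the count, \<open>1 / J\<close>, is the variation allowed to a bump.\<close>
  define J where "J = 8 * N\<^sup>2"
  have J: "J > 0" by (simp add: J_def N_def)
  obtain W where W: "openin T W" "\<one> \<in> W" "\<And>w. w \<in> W \<Longrightarrow> inv w \<in> W" "\<And>j. j \<le> J \<Longrightarrow> set_power G W j \<subseteq> V"
    using small_powers_neighbourhood [OF gt V(1,2)] by metis
  define S where "S x = {j. j < J \<and> x \<in> V <#> set_power G W j}" for x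
  define f where "f x = real (card (S x)) / real J" for x
  have finS: "finite (S x)" for x by (simp add: S_def)
  have cardS: "card (S x) \<le> J" for x
    using card_mono [of "{..<J}" "S x"] by (auto simp: S_def)
  have shift: "card (S x) \<le> Suc (card (S (x \<otimes> w)))" if xw: "x \<in> carrier G" "w \<in> W" for x w
  proof -
    have "Suc j \<in> insert J (S (x \<otimes> w))" if j: "j \<in> S x" for j
    proof -
      obtain v z where vz: "v \<in> V" "z \<in> set_power G W j" "x = v \<otimes> z" and "j < J"
        using j by (auto simp: S_def set_mult_def)
      have "z \<in> carrier G" using vz(2) W(4) [of j] \<open>j < J\<close> sub [OF V(1)] by auto
      moreover have "v \<in> carrier G" "w \<in> carrier G"
        using vz(1) xw(2) sub [OF V(1)] sub [OF W(1)] by auto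
      ultimately have "x \<otimes> w = v \<otimes> (z \<otimes> w)" using vz(3) by (simp add: m_assoc)
      moreover have "z \<otimes> w \<in> set_power G W (Suc j)" using vz xw by (auto simp: set_mult_def)
      ultimately have "x \<otimes> w \<in> V <#> set_power G W (Suc j)" using vz(1) unfolding set_mult_def by blast
      then show ?thesis using \<open>j < J\<close> by (auto simp: S_def)
    qed
    then have "card (Suc ` S x) \<le> card (insert J (S (x \<otimes> w)))"
      using finS by (intro card_mono) auto
    then show ?thesis using finS by (simp add: card_image card_insert_if split: if_splits)
  qed
  have slow: "\<bar>f (x \<otimes> w) - f x\<bar> \<le> 1 / (8 * real N ^ 2)" if xw: "x \<in> carrier G" "w \<in> W" for x w
  proof -
    have wc: "w \<in> carrier G" using xw sub [OF W(1)] by auto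
    have "card (S (x \<otimes> w)) \<le> Suc (card (S (x \<otimes> w \<otimes> inv w)))"
      using xw wc by (intro shift W(3)) auto
    then have "card (S (x \<otimes> w)) \<le> Suc (card (S x))" using xw wc by (simp add: m_assoc)
    with shift [OF xw] have "\<bar>real (card (S (x \<otimes> w))) - real (card (S x))\<bar> \<le> 1" by linarith
    then have "\<bar>real (card (S (x \<otimes> w))) - real (card (S x))\<bar> / real J \<le> 1 / real J"
      by (intro divide_right_mono) auto
    moreover have "\<bar>f (x \<otimes> w) - f x\<bar> = \<bar>real (card (S (x \<otimes> w))) - real (card (S x))\<bar> / real J"
      using J by (simp add: f_def abs_divide flip: diff_divide_distrib)
    ultimately show ?thesis by (simp add: J_def)
  qed
  have one: "f x = 1" if "x \<in> V" for x
  proof -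
    have "\<one> \<in> set_power G W j" for j using W(2) by (induction j) (force simp: set_mult_def)+
    moreover have "x = x \<otimes> \<one>" using that sub [OF V(1)] by auto
    ultimately have "S x = {..<J}" using that unfolding S_def set_mult_def by blast
    then show ?thesis using J by (simp add: f_def)
  qed
  have supp: "b \<in> V2" if "f b \<noteq> 0" for b
  proof -
    have "S b \<noteq> {}" using that by (auto simp: f_def)
    then obtain j where "j < J" "b \<in> V <#> set_power G W j" by (auto simp: S_def)
    then show ?thesis using W(4) [of j] V(4) by (auto simp: set_mult_def)
  qed
  show thesis
  proof
    show "bump G V W f \<C> N"
      by unfold_locales
        (use C slow one J cardS in \<open>auto simp: N_def f_def\<close>)
    show "a \<otimes> b \<otimes> x \<noteq> a' \<otimes> b'" if "a \<in> V" "a' \<in> V" "b \<in> carrier G" "b' \<in> carrier G" "f b \<noteq> 0" "f b' \<noteq> 0"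
        "x \<in> carrier G - U" for a a' b b' x
    proof
      assume eq: "a \<otimes> b \<otimes> x = a' \<otimes> b'"
      have cl: "a \<in> carrier G" "a' \<in> carrier G" using that sub [OF V(1)] by auto
      have "a \<otimes> b \<in> V1" "a' \<otimes> b' \<in> V1" using that supp V(3) V2(4) by auto
      then have "inv (a \<otimes> b) \<otimes> (a' \<otimes> b') \<in> U" using V1 by auto
      moreover have "inv (a \<otimes> b) \<otimes> (a' \<otimes> b') = x"
      proof -
        have c: "a \<otimes> b \<in> carrier G" "x \<in> carrier G" using cl that by auto
        then have "inv (a \<otimes> b) \<otimes> ((a \<otimes> b) \<otimes> x) = (inv (a \<otimes> b) \<otimes> (a \<otimes> b)) \<otimes> x"
          by (simp only: m_assoc inv_closed)
        then show ?thesis unfolding eq [symmetric] using c by simp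
      qed
      ultimately show False using that by simp
    qed
  qed (use W sub [OF V(1)] in auto)
qed

section \<open>Characters of totally bounded groups\<close>

lemma compact_angles: "compact (UNIV \<rightarrow>\<^sub>E {0..2 * pi :: real} :: ('a \<Rightarrow> real) set)"
proof -
  have "compactin (product_topology (\<lambda>_::'a. euclidean) UNIV) (UNIV \<rightarrow>\<^sub>E {0..2 * pi :: real})"
    by (simp add: compactin_PiE)
  then show ?thesis by (simp add: euclidean_product_topology)
qed

lemma continuous_on_phase: "continuous_on UNIV (\<lambda>\<theta>. phase I \<theta> d)"
  unfolding phase_def by (intro continuous_intros continuous_on_product_coordinates)

lemma phase_int_multiple: "phase I \<theta> (\<lambda>g. int n * d g) = phase I \<theta> d ^ n"
  by (simp add: phase_def Complex.DeMoivre sum_distrib_left mult_ac)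

context comm_group
begin

lemma word_map_int_multiple:
  assumes I: "finite I" "I \<subseteq> carrier G" "\<And>i. i \<notin> I \<Longrightarrow> d i = 0" and d: "word_map G d = \<one>"
  shows "word_map G (\<lambda>g. int n * d g) = \<one>"
proof (induction n)
  case 0
  then show ?case by (simp add: word_map_def)
next
  case (Suc n)
  have "(\<lambda>g. int (Suc n) * d g) = (\<lambda>g. int n * d g) + d"
    by (auto simp: fun_eq_iff algebra_simps)
  then have "word_map G (\<lambda>g. int (Suc n) * d g) = word_map G ((\<lambda>g. int n * d g) + d)" by simp
  also have "\<dots> = word_map G (\<lambda>g. int n * d g) \<otimes> word_map G d"
    using I by (intro word_map_add) auto
  finally show ?case using Suc d by simp
qed

text \<open>Any assignment of angles is a character of the free abelian group. If it stays close to \<open>1\<close> on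
  the preimage of \<open>W\<close>, it stays close to \<open>1\<close> on all multiples of each relation \<open>unit_vec x + unit_vec y - unit_vec (x \<otimes> y)\<close>,
  hence equals \<open>1\<close> there and descends to \<open>G\<close>. So being close to \<open>1\<close> on that preimage, a closed condition, is all
  that has to be preserved in the limit.\<close>

lemma character_of_angles:
  assumes "\<And>d. finite {g. d g \<noteq> 0} \<Longrightarrow> {g. d g \<noteq> 0} \<subseteq> carrier G \<Longrightarrow> word_map G d \<in> W \<Longrightarrow>
      norm (phase {g. d g \<noteq> 0} \<theta> d - 1) \<le> 1" and "\<one> \<in> W"
  shows "character G (\<lambda>x. cis (\<theta> x))"
  unfolding character_def
proof (intro conjI ballI)
  fix x y assume xy: "x \<in> carrier G" "y \<in> carrier G"
  define I where "I = {x, y, x \<otimes> y}"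
  define d where "d = unit_vec x + unit_vec y - unit_vec (x \<otimes> y)"
  have I: "finite I" "I \<subseteq> carrier G" using xy by (auto simp: I_def)
  have d0: "i \<notin> I \<Longrightarrow> d i = 0" for i by (auto simp: I_def d_def unit_vec_def)
  have dc: "word_map G d \<in> carrier G" using I d0 by (rule word_map_closed)
  have "word_map G d \<otimes> word_map G (unit_vec (x \<otimes> y)) = word_map G (d + unit_vec (x \<otimes> y))"
    using I d0 by (intro word_map_add [of I, symmetric]) (auto simp: I_def unit_vec_def)
  also have "d + unit_vec (x \<otimes> y) = unit_vec x + unit_vec y" by (simp add: d_def)
  also have "word_map G (unit_vec x + unit_vec y) = word_map G (unit_vec x) \<otimes> word_map G (unit_vec y)"
    using I by (intro word_map_add [of I]) (auto simp: I_def unit_vec_def)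
  finally have "word_map G d \<otimes> (x \<otimes> y) = x \<otimes> y" using xy by (simp add: word_map_unit_vec)
  then have d1: "word_map G d = \<one>" using xy dc by (metis m_closed r_cancel_one')
  have "norm (phase I \<theta> d ^ n - 1) \<le> 1" for n
  proof -
    define nd where "nd = (\<lambda>g. int n * d g)"
    have sub: "{g. nd g \<noteq> 0} \<subseteq> I" using d0 by (auto simp: nd_def)
    have "word_map G nd \<in> W"
      unfolding nd_def using word_map_int_multiple [OF I d0 d1] assms(2) by simp
    moreover have "finite {g. nd g \<noteq> 0}" "{g. nd g \<noteq> 0} \<subseteq> carrier G"
      using sub I finite_subset by blast+
    ultimately have "norm (phase {g. nd g \<noteq> 0} \<theta> nd - 1) \<le> 1" by (intro assms(1))
    moreover have "phase I \<theta> nd = phase {g. nd g \<noteq> 0} \<theta> nd"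
      using I sub by (intro phase_superset) auto
    ultimately show ?thesis by (simp add: nd_def phase_int_multiple)
  qed
  then have "phase I \<theta> d = 1" by (intro unit_complex_all_powers_close_imp_one) simp
  then have "cis (\<theta> x) * cis (\<theta> y) * cnj (cis (\<theta> (x \<otimes> y))) = 1"
    using I by (simp add: d_def phase_diff phase_add phase_unit_vec I_def)
  then have "cis (\<theta> x + \<theta> y - \<theta> (x \<otimes> y)) = 1" by (simp add: cis_cnj cis_mult)
  then have "cis (\<theta> x + \<theta> y - \<theta> (x \<otimes> y)) * cis (\<theta> (x \<otimes> y)) = cis (\<theta> (x \<otimes> y))" by simp
  then show "cis (\<theta> (x \<otimes> y)) = cis (\<theta> x) * cis (\<theta> y)" by (simp add: cis_mult)
qed simp

end

text \<open>Both requirements, closeness to \<open>1\<close> on the preimage of \<open>W\<close> and distance from \<open>1\<close> at \<open>x0\<close>, are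
  closed conditions on the angles; \<open>approximate_character\<close> satisfies finitely many at a
  time, and Tychonoff's theorem satisfies all of them.\<close>

lemma (in bump) character_exists:
  assumes x0: "x0 \<in> carrier G"
    and far: "\<And>a a' b b'. a \<in> V \<Longrightarrow> a' \<in> V \<Longrightarrow> b \<in> carrier G \<Longrightarrow> b' \<in> carrier G \<Longrightarrow>
        f b \<noteq> 0 \<Longrightarrow> f b' \<noteq> 0 \<Longrightarrow> a \<otimes> b \<otimes> x0 \<noteq> a' \<otimes> b'"
    and V: "V \<subseteq> carrier G" and W: "\<one> \<in> W" "W \<subseteq> carrier G"
  obtains \<phi> where "character G \<phi>" "\<And>w. w \<in> W \<Longrightarrow> norm (\<phi> w - 1) \<le> 1"
    "1 / (8 * real N ^ 4) \<le> norm (\<phi> x0 - 1)"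
proof -
  define \<D> where "\<D> = {d. finite {g. d g \<noteq> 0} \<and> {g. d g \<noteq> 0} \<subseteq> carrier G \<and> word_map G d \<in> W}"
  define K where "K = (UNIV \<rightarrow>\<^sub>E {0..2 * pi} :: ('a \<Rightarrow> real) set)"
  define F where "F d = {\<theta>. norm (phase {g. d g \<noteq> 0} \<theta> d - 1) \<le> 1} \<inter> {\<theta>. 1 / (8 * real N ^ 4) \<le> 1 - cos (\<theta> x0)}" for d
  have zero: "(\<lambda>_. 0) \<in> \<D>" using W by (simp add: \<D>_def word_map_def)
  have "K \<inter> (\<Inter>d\<in>\<D>. F d) \<noteq> {}"
  proof (rule compact_imp_fip_image)
    show "compact K" unfolding K_def by (rule compact_angles)
    show "closed (F d)" if "d \<in> \<D>" for d
    proof -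
      have "continuous_on UNIV (\<lambda>\<theta> :: 'a \<Rightarrow> real. cos (\<theta> x0))"
        by (rule continuous_on_compose2 [of UNIV cos])
          (auto intro!: continuous_at_imp_continuous_on continuous_on_product_coordinates)
      then show ?thesis unfolding F_def
        by (intro closed_Int closed_Collect_le continuous_intros continuous_on_phase)
    qed
    fix \<D>' assume fin: "finite \<D>'" and sub: "\<D>' \<subseteq> \<D>"
    define I where "I = insert x0 (\<Union>d\<in>\<D>'. {g. d g \<noteq> 0})"
    have I: "finite I" "I \<subseteq> carrier G" "x0 \<in> I"
      using fin sub x0 by (auto simp: I_def \<D>_def)
    obtain \<theta> where \<theta>: "\<And>i. \<theta> i \<in> {0..2 * pi}" "\<And>d. d \<in> \<D>' \<Longrightarrow> norm (phase I \<theta> d - 1) \<le> 1"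
      "1 / (8 * real N ^ 4) \<le> 1 - cos (\<theta> x0)"
    proof (rule approximate_character [OF I far V fin])
      show "d i = 0" if "d \<in> \<D>'" "i \<notin> I" for d i using that by (auto simp: I_def)
      show "word_map G d \<in> W" if "d \<in> \<D>'" for d using that sub by (auto simp: \<D>_def)
    qed auto
    have "phase {g. d g \<noteq> 0} \<theta> d = phase I \<theta> d" if "d \<in> \<D>'" for d
      using I that by (intro phase_superset [symmetric]) (auto simp: I_def)
    then have "\<theta> \<in> K \<inter> (\<Inter>d\<in>\<D>'. F d)"
      using \<theta> by (auto simp: K_def F_def)
    then show "K \<inter> (\<Inter>d\<in>\<D>'. F d) \<noteq> {}" by blast
  qed
  then obtain \<theta> where \<theta>: "\<And>d. d \<in> \<D> \<Longrightarrow> \<theta> \<in> F d" by blast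
  have phase_close: "norm (phase {g. d g \<noteq> 0} \<theta> d - 1) \<le> 1"
    if "finite {g. d g \<noteq> 0}" "{g. d g \<noteq> 0} \<subseteq> carrier G" "word_map G d \<in> W" for d
    using \<theta> [of d] that by (auto simp: \<D>_def F_def)
  show thesis
  proof (rule that)
    show "character G (\<lambda>x. cis (\<theta> x))"
      using phase_close W(1) by (rule character_of_angles)
    have "1 / (8 * real N ^ 4) \<le> 1 - cos (\<theta> x0)" using \<theta> [OF zero] by (simp add: F_def)
    also have "\<dots> \<le> \<bar>Re (cis (\<theta> x0) - 1)\<bar>" by simp
    also have "\<dots> \<le> norm (cis (\<theta> x0) - 1)" by (rule abs_Re_le_cmod)
    finally show "1 / (8 * real N ^ 4) \<le> norm (cis (\<theta> x0) - 1)" .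
    fix w assume w: "w \<in> W"
    have s: "{g. unit_vec w g \<noteq> 0} = {w}" by (auto simp: unit_vec_def)
    have "norm (phase {w} \<theta> (unit_vec w) - 1) \<le> 1"
      using phase_close [of "unit_vec w"] w W word_map_unit_vec [of w] by (auto simp: s)
    then show "norm (cis (\<theta> w) - 1) \<le> 1" by (simp add: phase_unit_vec)
  qed
qed

text \<open>By equicontinuity a character is determined up to a small error by its values at
  one point of each member of a small cover, and those values are determined up to a small error by a
  finite amount of information.\<close>

lemma (in group) finite_character_net:
  assumes T: "totally_bounded_group_topology G T" and W: "openin T W" "\<one> \<in> W" and "\<epsilon> > 0"
    and X: "\<And>\<phi>. \<phi> \<in> X \<Longrightarrow> character G \<phi>" "\<And>\<phi> w. \<phi> \<in> X \<Longrightarrow> w \<in> W \<Longrightarrow> norm (\<phi> w - 1) \<le> 1"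
  obtains Y where "finite Y" "Y \<subseteq> X" "\<And>\<phi>. \<phi> \<in> X \<Longrightarrow> \<exists>\<psi>\<in>Y. \<forall>x\<in>carrier G. norm (\<phi> x - \<psi> x) < \<epsilon>"
proof -
  have gt: "group_topology G T" using T by (simp add: totally_bounded_group_topology_def)
  obtain W' where W': "openin T W'" "\<one> \<in> W'"
    "\<And>\<phi> w. character G \<phi> \<Longrightarrow> (\<And>w. w \<in> W \<Longrightarrow> norm (\<phi> w - 1) \<le> 1) \<Longrightarrow> w \<in> W' \<Longrightarrow> norm (\<phi> w - 1) < \<epsilon> / 4"
    using equicontinuous_characters [OF gt W, of "\<epsilon> / 4"] \<open>\<epsilon> > 0\<close> by auto
  have "small_cover G W'" using T W' by (simp add: totally_bounded_group_topology_def)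
  then obtain \<C> where C: "finite \<C>" "\<Union>\<C> = carrier G" "\<forall>C\<in>\<C>. \<forall>x\<in>C. \<forall>y\<in>C. inv x \<otimes> y \<in> W'"
    by (rule small_coverE)
  define p where "p C = (SOME x. x \<in> C)" for C :: "'a set"
  have p: "p C \<in> C" if "x \<in> C" for x C using that unfolding p_def by (rule someI)
  have "compact (cball (0::complex) 1)" by simp
  then obtain Z where Z: "finite Z" "cball (0::complex) 1 \<subseteq> (\<Union>z\<in>Z. ball z (\<epsilon> / 4))"
    using \<open>\<epsilon> > 0\<close> compactE_image [of "cball (0::complex) 1" "cball 0 1" "\<lambda>z. ball z (\<epsilon> / 4)"]
    by (metis open_ball centre_in_ball subsetI UN_I zero_less_divide_iff zero_less_numeral)
  define q where "q u = (SOME z. z \<in> Z \<and> dist z u < \<epsilon> / 4)" for u :: complex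
  have q: "q u \<in> Z" "dist (q u) u < \<epsilon> / 4" if "norm u = 1" for u
  proof -
    have "u \<in> (\<Union>z\<in>Z. ball z (\<epsilon> / 4))" using that by (intro subsetD [OF Z(2)]) simp
    then have "\<exists>z. z \<in> Z \<and> dist z u < \<epsilon> / 4" by auto
    from someI_ex [OF this] show "q u \<in> Z" "dist (q u) u < \<epsilon> / 4" by (auto simp: q_def)
  qed
  \<comment> \<open>Characters with the same code are uniformly close; one representative of each code is kept.\<close>
  define \<Phi> where "\<Phi> \<phi> = (\<lambda>C\<in>{C \<in> \<C>. C \<noteq> {}}. q (\<phi> (p C)))" for \<phi> :: "'a \<Rightarrow> complex"
  have pc: "p C \<in> carrier G" if "C \<in> \<C>" "C \<noteq> {}" for C using p C(2) that by blast
  have "\<Phi> ` X \<subseteq> {C \<in> \<C>. C \<noteq> {}} \<rightarrow>\<^sub>E Z"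
  proof (rule image_subsetI)
    fix \<phi> assume "\<phi> \<in> X"
    then have "q (\<phi> (p C)) \<in> Z" if "C \<in> {C \<in> \<C>. C \<noteq> {}}" for C
      using X(1) q(1) pc that by (simp add: character_def)
    then show "\<Phi> \<phi> \<in> {C \<in> \<C>. C \<noteq> {}} \<rightarrow>\<^sub>E Z" unfolding \<Phi>_def restrict_PiE_iff by blast
  qed
  moreover have "finite ({C \<in> \<C>. C \<noteq> {}} \<rightarrow>\<^sub>E Z)" using C(1) Z(1) by (intro finite_PiE) auto
  ultimately have fin: "finite (\<Phi> ` X)" by (rule finite_subset)
  show thesis
  proof
    show "finite (inv_into X \<Phi> ` \<Phi> ` X)" using fin by (rule finite_imageI)
    show "inv_into X \<Phi> ` \<Phi> ` X \<subseteq> X" by (auto intro: inv_into_into)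
    fix \<phi> assume \<phi>: "\<phi> \<in> X"
    define \<psi> where "\<psi> = inv_into X \<Phi> (\<Phi> \<phi>)"
    have \<psi>: "\<psi> \<in> X" "\<Phi> \<psi> = \<Phi> \<phi>" using \<phi> by (auto simp: \<psi>_def inv_into_into f_inv_into_f)
    have "norm (\<phi> x - \<psi> x) < \<epsilon>" if x: "x \<in> carrier G" for x
    proof -
      obtain D where D: "D \<in> \<C>" "x \<in> D" using C(2) x by blast
      then have pD: "p D \<in> D" "D \<noteq> {}" using p by auto
      then have pG: "p D \<in> carrier G" using pc D(1) by blast
      have w: "inv (p D) \<otimes> x \<in> W'" using C(3) D pD by blast
      have close: "norm (\<phi>' x - \<phi>' (p D)) < \<epsilon> / 4" if "\<phi>' \<in> X" for \<phi>'
        using W'(3) [OF X(1) [OF that] X(2) [OF that] w] character_diff [OF X(1) [OF that] pG x] by simp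
      have "\<Phi> \<psi> D = \<Phi> \<phi> D" using \<psi> by simp
      then have "q (\<psi> (p D)) = q (\<phi> (p D))" using D pD by (simp add: \<Phi>_def)
      moreover have "norm (\<phi> (p D)) = 1" "norm (\<psi> (p D)) = 1"
        using X(1) \<phi> \<psi>(1) pG by (auto simp: character_def)
      ultimately have "dist (q (\<phi> (p D))) (\<phi> (p D)) < \<epsilon> / 4" "dist (q (\<phi> (p D))) (\<psi> (p D)) < \<epsilon> / 4"
        using q(2) by metis+
      then have "dist (\<phi> (p D)) (\<psi> (p D)) < \<epsilon> / 2"
        using dist_triangle3 [of "\<phi> (p D)" "\<psi> (p D)" "q (\<phi> (p D))"] by linarith
      moreover have "dist (\<phi> x) (\<phi> (p D)) < \<epsilon> / 4" "dist (\<psi> (p D)) (\<psi> x) < \<epsilon> / 4"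
        using close [OF \<phi>] close [OF \<psi>(1)] by (auto simp: dist_norm norm_minus_commute)
      ultimately have "dist (\<phi> x) (\<psi> x) < \<epsilon>"
        using dist_triangle [of "\<phi> x" "\<psi> x" "\<phi> (p D)"] dist_triangle [of "\<phi> (p D)" "\<psi> x" "\<psi> (p D)"] by linarith
      then show ?thesis by (simp add: dist_norm)
    qed
    then show "\<exists>\<psi>\<in>inv_into X \<Phi> ` \<Phi> ` X. \<forall>x\<in>carrier G. norm (\<phi> x - \<psi> x) < \<epsilon>"
      using \<phi> by (intro bexI [of _ \<psi>]) (auto simp: \<psi>_def)
  qed
qed

text \<open>Every point outside \<open>U\<close> is moved a definite distance by some member of one equicontinuous family
  of characters, and a finite net of that family then does the same with half the distance.\<close>

theorem (in comm_group) characters_determine_totally_bounded_topology: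
  assumes T: "totally_bounded_group_topology G T" and U: "openin T U" "\<one> \<in> U"
  obtains Y \<delta> where "finite Y" "\<And>\<phi>. \<phi> \<in> Y \<Longrightarrow> continuous_character G T \<phi>" "\<delta> > 0"
    "\<And>x. x \<in> carrier G \<Longrightarrow> (\<And>\<phi>. \<phi> \<in> Y \<Longrightarrow> norm (\<phi> x - 1) < \<delta>) \<Longrightarrow> x \<in> U"
proof -
  have gt: "group_topology G T" using T by (simp add: totally_bounded_group_topology_def)
  obtain V W f \<C> N where b: "bump G V W f \<C> N" and V: "V \<subseteq> carrier G" and W: "openin T W" "\<one> \<in> W"
    and far: "\<And>a a' b b' x. a \<in> V \<Longrightarrow> a' \<in> V \<Longrightarrow> b \<in> carrier G \<Longrightarrow> b' \<in> carrier G \<Longrightarrow> f b \<noteq> 0 \<Longrightarrow> f b' \<noteq> 0 \<Longrightarrow>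
        x \<in> carrier G - U \<Longrightarrow> a \<otimes> b \<otimes> x \<noteq> a' \<otimes> b'"
    using bump_exists [OF T U] by blast
  interpret bump G V W f \<C> N by (rule b)
  have WG: "W \<subseteq> carrier G" using openin_subset [OF W(1)] gt by (simp add: group_topology_def)
  define X where "X = {\<phi>. character G \<phi> \<and> (\<forall>w\<in>W. norm (\<phi> w - 1) \<le> 1)}"
  define \<delta> where "\<delta> = 1 / (16 * real N ^ 4)"
  have \<delta>: "\<delta> > 0" using N by (simp add: \<delta>_def)
  obtain Y where Y: "finite Y" "Y \<subseteq> X" "\<And>\<phi>. \<phi> \<in> X \<Longrightarrow> \<exists>\<psi>\<in>Y. \<forall>x\<in>carrier G. norm (\<phi> x - \<psi> x) < \<delta>"
    by (rule finite_character_net [OF T W \<delta>, of X]) (auto simp: X_def)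
  show thesis
  proof (rule that [OF Y(1) _ \<delta>])
    show "continuous_character G T \<phi>" if "\<phi> \<in> Y" for \<phi>
      unfolding continuous_character_def
    proof (intro conjI allI impI)
      show ch: "character G \<phi>" using that Y(2) by (auto simp: X_def)
      fix \<epsilon> :: real assume "\<epsilon> > 0"
      then obtain W' where "openin T W'" "\<one> \<in> W'"
        "\<And>\<phi> w. character G \<phi> \<Longrightarrow> (\<And>w. w \<in> W \<Longrightarrow> norm (\<phi> w - 1) \<le> 1) \<Longrightarrow> w \<in> W' \<Longrightarrow> norm (\<phi> w - 1) < \<epsilon>"
        using equicontinuous_characters [OF gt W] by blast
      moreover have "\<And>w. w \<in> W \<Longrightarrow> norm (\<phi> w - 1) \<le> 1" using that Y(2) by (auto simp: X_def)
      ultimately show "\<exists>W. openin T W \<and> \<one> \<in> W \<and> (\<forall>w\<in>W. norm (\<phi> w - 1) < \<epsilon>)"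
        using ch by (intro exI [of _ W']) auto
    qed
    fix x assume x: "x \<in> carrier G" and small: "\<And>\<phi>. \<phi> \<in> Y \<Longrightarrow> norm (\<phi> x - 1) < \<delta>"
    show "x \<in> U"
    proof (rule ccontr)
      assume "x \<notin> U"
      then have xU: "x \<in> carrier G - U" using x by simp
      have "a \<otimes> b \<otimes> x \<noteq> a' \<otimes> b'" if "a \<in> V" "a' \<in> V" "b \<in> carrier G" "b' \<in> carrier G" "f b \<noteq> 0" "f b' \<noteq> 0"
        for a a' b b' by (rule far [OF that xU])
      then obtain \<phi> where \<phi>: "character G \<phi>" "\<And>w. w \<in> W \<Longrightarrow> norm (\<phi> w - 1) \<le> 1" "1 / (8 * real N ^ 4) \<le> norm (\<phi> x - 1)"
        using character_exists [OF x _ V W(2) WG] by blast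
      then have "\<phi> \<in> X" by (simp add: X_def)
      then obtain \<psi> where \<psi>: "\<psi> \<in> Y" "norm (\<phi> x - \<psi> x) < \<delta>" using Y(3) x by blast
      have "norm (\<phi> x - 1) \<le> norm (\<phi> x - \<psi> x) + norm (\<psi> x - 1)"
        using norm_triangle_ineq [of "\<phi> x - \<psi> x" "\<psi> x - 1"] by simp
      also have "\<dots> < \<delta> + \<delta>" using \<psi>(2) small [OF \<psi>(1)] by linarith
      also have "\<dots> = 1 / (8 * real N ^ 4)" using N by (simp add: \<delta>_def field_simps)
      finally show False using \<phi>(3) by simp
    qed
  qed
qed

section \<open>Extension of characters from subgroups\<close>

text \<open>Partial characters on subgroups, encoded as subgroups of \<open>G \<times> \<complex>\<close> so that they are ordered by
  inclusion and unions of chains are at hand for Zorn's lemma. Single-valuedness at the unit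
  propagates to all points.\<close>

definition character_graph :: "('a, 'm) monoid_scheme \<Rightarrow> ('a \<times> complex) set \<Rightarrow> bool" where
  "character_graph G \<Gamma> \<longleftrightarrow> \<Gamma> \<subseteq> carrier G \<times> sphere 0 1 \<and> (\<one>\<^bsub>G\<^esub>, 1) \<in> \<Gamma> \<and>
     (\<forall>x a y b. (x, a) \<in> \<Gamma> \<longrightarrow> (y, b) \<in> \<Gamma> \<longrightarrow> (x \<otimes>\<^bsub>G\<^esub> y, a * b) \<in> \<Gamma>) \<and>
     (\<forall>x a. (x, a) \<in> \<Gamma> \<longrightarrow> (inv\<^bsub>G\<^esub> x, inverse a) \<in> \<Gamma>) \<and>
     (\<forall>a. (\<one>\<^bsub>G\<^esub>, a) \<in> \<Gamma> \<longrightarrow> a = 1)"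

context comm_group
begin

lemma character_graph_unique:
  assumes \<Gamma>: "character_graph G \<Gamma>" and "(x, a) \<in> \<Gamma>" "(x, b) \<in> \<Gamma>"
  shows "a = b"
proof -
  have x: "x \<in> carrier G" and "norm b = 1" using assms by (auto simp: character_graph_def)
  then have "b \<noteq> 0" by auto
  have "(x \<otimes> inv x, a * inverse b) \<in> \<Gamma>" using assms unfolding character_graph_def by blast
  then have "a * inverse b = 1" using x \<Gamma> unfolding character_graph_def by simp
  then show ?thesis using \<open>b \<noteq> 0\<close> by (simp add: field_simps)
qed

lemma character_graph_int_pow:
  assumes \<Gamma>: "character_graph G \<Gamma>" and xa: "(x, a) \<in> \<Gamma>"
  shows "(x [^] (q::int), a powi q) \<in> \<Gamma>"
proof -
  have x: "x \<in> carrier G" using assms by (auto simp: character_graph_def)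
  have nat: "(x [^] (n::nat), a ^ n) \<in> \<Gamma>" for n
  proof (induction n)
    case 0
    then show ?case using \<Gamma> by (simp add: character_graph_def)
  next
    case (Suc n)
    then have "(x [^] n \<otimes> x, a ^ n * a) \<in> \<Gamma>" using \<Gamma> xa unfolding character_graph_def by blast
    then show ?case by (simp add: mult.commute)
  qed
  show ?thesis
  proof (cases q rule: int_cases2)
    case (nonneg n)
    then show ?thesis using nat [of n] by (simp add: int_pow_int)
  next
    case (nonpos n)
    have "(inv (x [^] n), inverse (a ^ n)) \<in> \<Gamma>"
      using \<Gamma> nat [of n] unfolding character_graph_def by blast
    then show ?thesis using nonpos x by (simp add: int_pow_neg int_pow_int power_int_minus)
  qed
qed

text \<open>Divisibility of the circle: if \<open>x [^] m\<close> is the first positive power of \<open>x\<close> in the domain, any \<open>m\<close>-th root of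
  its value is a consistent choice for the value at \<open>x\<close>; if there is none, every value is.\<close>

lemma root_for_graph_extension:
  assumes \<Gamma>: "character_graph G \<Gamma>" and x: "x \<in> carrier G"
  obtains w where "norm w = 1" "\<And>n a. (x [^] (n::int), a) \<in> \<Gamma> \<Longrightarrow> w powi n = a"
proof -
  have neg: "(x [^] (- n), inverse a) \<in> \<Gamma>" if "(x [^] (n::int), a) \<in> \<Gamma>" for n a
    using \<Gamma> that x unfolding character_graph_def by (metis int_pow_neg)
  define P where "P m \<longleftrightarrow> m > 0 \<and> (\<exists>a. (x [^] int m, a) \<in> \<Gamma>)" for m
  show thesis
  proof (cases "\<exists>m. P m")
    case False
    show thesis
    proof (rule that [of 1])
      fix n :: int and a assume na: "(x [^] n, a) \<in> \<Gamma>"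
      have "n = 0"
      proof (cases n rule: int_cases2)
        case (nonneg k)
        then show ?thesis using False na by (auto simp: P_def)
      next
        case (nonpos k)
        then show ?thesis using False neg [OF na] by (auto simp: P_def)
      qed
      then show "1 powi n = a" using na \<Gamma> by (simp add: character_graph_def)
    qed simp
  next
    case True
    define m where "m = (LEAST m. P m)"
    have m: "P m" using True unfolding m_def by (rule LeastI_ex)
    have least: "\<not> P k" if "k < m" for k using that unfolding m_def by (rule not_less_Least)
    obtain a0 where a0: "(x [^] int m, a0) \<in> \<Gamma>" and "m > 0" using m by (auto simp: P_def)
    have "norm a0 = 1" using a0 \<Gamma> by (auto simp: character_graph_def)
    define w where "w = cis (Arg a0 / real m)"
    have "a0 \<noteq> 0" using \<open>norm a0 = 1\<close> by auto
    then have wm: "w ^ m = a0"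
      using \<open>m > 0\<close> \<open>norm a0 = 1\<close> cis_Arg [of a0]
      by (simp add: w_def Complex.DeMoivre sgn_eq)
    show thesis
    proof (rule that [of w])
      show "norm w = 1" by (simp add: w_def)
      fix n :: int and a assume na: "(x [^] n, a) \<in> \<Gamma>"
      define q where "q = n div int m"
      define r where "r = n mod int m"
      have n: "n = int m * q + r" by (simp add: q_def r_def)
      have r: "0 \<le> r" "r < int m" using \<open>m > 0\<close> by (auto simp: r_def)
      have aq: "(x [^] (int m * q), a0 powi q) \<in> \<Gamma>"
        using character_graph_int_pow [OF \<Gamma> a0, of q] x by (simp add: int_pow_pow)
      have "(x [^] n \<otimes> x [^] (- (int m * q)), a * inverse (a0 powi q)) \<in> \<Gamma>"
        using \<Gamma> na neg [OF aq] unfolding character_graph_def by blast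
      moreover have "x [^] n \<otimes> x [^] (- (int m * q)) = x [^] r"
        using x by (simp add: n flip: int_pow_mult)
      ultimately have "\<exists>a. (x [^] int (nat r), a) \<in> \<Gamma>" using r by auto
      moreover have "nat r < m" using r by linarith
      ultimately have "nat r = 0" using least [of "nat r"] by (auto simp: P_def)
      then have n': "n = int m * q" using r n by simp
      then have "a = a0 powi q" using character_graph_unique [OF \<Gamma> na] aq by simp
      also have "\<dots> = w powi n" by (simp add: n' power_int_mult wm)
      finally show "w powi n = a" by simp
    qed
  qed
qed

lemma character_graph_extend:
  assumes \<Gamma>: "character_graph G \<Gamma>" and x: "x \<in> carrier G"
  obtains \<Gamma>' where "character_graph G \<Gamma>'" "\<Gamma> \<subseteq> \<Gamma>'" "x \<in> Domain \<Gamma>'"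
proof -
  obtain w where w: "norm w = 1" "\<And>n a. (x [^] (n::int), a) \<in> \<Gamma> \<Longrightarrow> w powi n = a"
    using root_for_graph_extension [OF assms] by blast
  have w0: "w \<noteq> 0" using w(1) by auto
  have sub: "y \<in> carrier G" "norm a = 1" if "(y, a) \<in> \<Gamma>" for y a
    using \<Gamma> that by (auto simp: character_graph_def)
  have one: "(\<one>, 1) \<in> \<Gamma>" using \<Gamma> by (simp add: character_graph_def)
  define \<Gamma>' where "\<Gamma>' = {(y \<otimes> x [^] n, a * w powi n) |y a (n::int). (y, a) \<in> \<Gamma>}"
  have I: "(y \<otimes> x [^] n, a * w powi n) \<in> \<Gamma>'" if "(y, a) \<in> \<Gamma>" for y a and n :: int
    using that by (auto simp: \<Gamma>'_def)
  have E: "\<exists>y a n. p = (y \<otimes> x [^] (n::int), a * w powi n) \<and> (y, a) \<in> \<Gamma>" if "p \<in> \<Gamma>'" for p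
    using that by (auto simp: \<Gamma>'_def)
  show thesis
  proof
    show "\<Gamma> \<subseteq> \<Gamma>'"
    proof (rule subrelI)
      fix y a assume "(y, a) \<in> \<Gamma>"
      then show "(y, a) \<in> \<Gamma>'" using I [of y a 0] sub(1) by simp
    qed
    show "x \<in> Domain \<Gamma>'" using I [OF one, of 1] x by auto
    show "character_graph G \<Gamma>'"
      unfolding character_graph_def
    proof (intro conjI allI impI)
      show "\<Gamma>' \<subseteq> carrier G \<times> sphere 0 1"
        using sub x w by (auto simp: \<Gamma>'_def norm_mult norm_power_int)
      show "(\<one>, 1) \<in> \<Gamma>'" using I [OF one, of 0] by simp
    next
      fix y a z b assume "(y, a) \<in> \<Gamma>'" "(z, b) \<in> \<Gamma>'"
      then obtain y' a' m z' b' n where e: "y = y' \<otimes> x [^] (m::int)" "a = a' * w powi m" "(y', a') \<in> \<Gamma>"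
          "z = z' \<otimes> x [^] (n::int)" "b = b' * w powi n" "(z', b') \<in> \<Gamma>"
        using E by blast
      have "(y' \<otimes> z', a' * b') \<in> \<Gamma>" using \<Gamma> e unfolding character_graph_def by blast
      from I [OF this, of "m + n"] show "(y \<otimes> z, a * b) \<in> \<Gamma>'"
        using e sub(1) [OF e(3)] sub(1) [OF e(6)] x w0
        by (simp add: int_pow_mult power_int_add m_ac mult_ac)
    next
      fix y a assume "(y, a) \<in> \<Gamma>'"
      then obtain y' a' m where e: "y = y' \<otimes> x [^] (m::int)" "a = a' * w powi m" "(y', a') \<in> \<Gamma>"
        using E by blast
      have "(inv y', inverse a') \<in> \<Gamma>" using \<Gamma> e unfolding character_graph_def by blast
      from I [OF this, of "- m"] show "(inv y, inverse a) \<in> \<Gamma>'"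
        using e sub(1) [OF e(3)] x
        by (simp add: int_pow_neg power_int_minus inv_mult_group m_comm)
    next
      fix a assume "(\<one>, a) \<in> \<Gamma>'"
      then obtain y' a' m where e: "\<one> = y' \<otimes> x [^] (m::int)" "a = a' * w powi m" "(y', a') \<in> \<Gamma>"
        using E by blast
      have "y' = inv (x [^] m)"
        using e(1) sub(1) [OF e(3)] x by (metis inv_equality int_pow_closed)
      then have "(x [^] (- m), a') \<in> \<Gamma>" using e(3) x by (simp add: int_pow_neg)
      then have "a' = w powi (- m)" using w(2) by simp
      then show "a = 1" using e(2) w0 by (simp add: power_int_minus)
    qed
  qed
qed

theorem character_extension:
  assumes H: "subgroup H G" and \<phi>: "character (G\<lparr>carrier := H\<rparr>) \<phi>"
  obtains \<psi> where "character G \<psi>" "\<And>x. x \<in> H \<Longrightarrow> \<psi> x = \<phi> x"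
proof -
  interpret H: group "G\<lparr>carrier := H\<rparr>" using H by (rule subgroup_imp_group)
  have mult: "\<phi> (x \<otimes> y) = \<phi> x * \<phi> y" if "x \<in> H" "y \<in> H" for x y
    using \<phi> that by (simp add: character_def)
  have unit: "norm (\<phi> x) = 1" if "x \<in> H" for x using \<phi> that by (simp add: character_def)
  have phi_one: "\<phi> \<one> = 1" using H.character_one [OF \<phi>] by simp
  note sg = subgroup.m_closed [OF H] subgroup.m_inv_closed [OF H] subgroup.one_closed [OF H]
  have HG: "H \<subseteq> carrier G" using H by (rule subgroup.subset)
  define \<Gamma>0 where "\<Gamma>0 = (\<lambda>x. (x, \<phi> x)) ` H"
  define \<A> where "\<A> = {\<Gamma>. character_graph G \<Gamma> \<and> \<Gamma>0 \<subseteq> \<Gamma>}"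
  have "character_graph G \<Gamma>0"
    unfolding character_graph_def
  proof (intro conjI allI impI)
    show "\<Gamma>0 \<subseteq> carrier G \<times> sphere 0 1" using HG unit by (auto simp: \<Gamma>0_def)
    show "(\<one>, 1) \<in> \<Gamma>0" using sg phi_one by (auto simp: \<Gamma>0_def image_iff)
    show "(x \<otimes> y, a * b) \<in> \<Gamma>0" if "(x, a) \<in> \<Gamma>0" "(y, b) \<in> \<Gamma>0" for x a y b
      using that sg(1) mult by (auto simp: \<Gamma>0_def)
    show "(inv x, inverse a) \<in> \<Gamma>0" if "(x, a) \<in> \<Gamma>0" for x a
    proof -
      have x: "x \<in> H" "a = \<phi> x" using that by (auto simp: \<Gamma>0_def)
      have "\<phi> x * \<phi> (inv x) = 1"
        using mult [OF x(1) sg(2) [OF x(1)]] x HG phi_one by auto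
      then have "inverse a = \<phi> (inv x)" using x(2) by (simp add: inverse_unique)
      then show ?thesis using sg(2) [OF x(1)] by (auto simp: \<Gamma>0_def)
    qed
    show "a = 1" if "(\<one>, a) \<in> \<Gamma>0" for a using that phi_one by (auto simp: \<Gamma>0_def)
  qed
  then have "\<A> \<noteq> {}" by (auto simp: \<A>_def)
  moreover have "\<Union>\<K> \<in> \<A>" if ne: "\<K> \<noteq> {}" and chain: "subset.chain \<A> \<K>" for \<K>
  proof -
    have sub: "\<K> \<subseteq> \<A>" using chain by (simp add: subset.chain_def)
    have graph: "character_graph G K" if "K \<in> \<K>" for K using sub that by (auto simp: \<A>_def)
    have common: "\<exists>K\<in>\<K>. p \<in> K \<and> q \<in> K" if pq: "p \<in> \<Union>\<K>" "q \<in> \<Union>\<K>" for p q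
    proof -
      obtain A B where AB: "A \<in> \<K>" "B \<in> \<K>" "p \<in> A" "q \<in> B" using pq by blast
      have "A \<subseteq> B \<or> B \<subseteq> A" using chain AB(1,2) unfolding subset_chain_def by blast
      then show ?thesis using AB by blast
    qed
    have "character_graph G (\<Union>\<K>)"
      unfolding character_graph_def
    proof (intro conjI allI impI)
      show "\<Union>\<K> \<subseteq> carrier G \<times> sphere 0 1"
        using graph by (intro Union_least) (simp add: character_graph_def)
      show "(\<one>, 1) \<in> \<Union>\<K>" using ne graph by (auto simp: character_graph_def)
      show "(x \<otimes> y, a * b) \<in> \<Union>\<K>" if xy: "(x, a) \<in> \<Union>\<K>" "(y, b) \<in> \<Union>\<K>" for x a y b
      proof -
        obtain K where K: "K \<in> \<K>" "(x, a) \<in> K" "(y, b) \<in> K" using common [OF xy] by blast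
        then have "(x \<otimes> y, a * b) \<in> K" using graph [OF K(1)] unfolding character_graph_def by blast
        then show ?thesis using K(1) by blast
      qed
      show "(inv x, inverse a) \<in> \<Union>\<K>" if xa: "(x, a) \<in> \<Union>\<K>" for x a
      proof -
        obtain K where K: "K \<in> \<K>" "(x, a) \<in> K" using xa by blast
        then have "(inv x, inverse a) \<in> K" using graph [OF K(1)] unfolding character_graph_def by blast
        then show ?thesis using K(1) by blast
      qed
      show "a = 1" if a: "(\<one>, a) \<in> \<Union>\<K>" for a
      proof -
        obtain K where K: "K \<in> \<K>" "(\<one>, a) \<in> K" using a by blast
        then show ?thesis using graph [OF K(1)] unfolding character_graph_def by blast
      qed
    qed
    moreover have "\<Gamma>0 \<subseteq> \<Union>\<K>" using ne sub by (force simp: \<A>_def)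
    ultimately show ?thesis by (simp add: \<A>_def)
  qed
  ultimately obtain M where M: "M \<in> \<A>" "\<And>X. X \<in> \<A> \<Longrightarrow> M \<subseteq> X \<Longrightarrow> X = M"
    using subset_Zorn_nonempty [of \<A>] by blast
  have graph: "character_graph G M" and ext: "\<Gamma>0 \<subseteq> M" using M(1) by (auto simp: \<A>_def)
  have total: "\<exists>a. (x, a) \<in> M" if x: "x \<in> carrier G" for x
  proof -
    obtain M' where M': "character_graph G M'" "M \<subseteq> M'" "x \<in> Domain M'"
      using character_graph_extend [OF graph x] by blast
    then have "M' = M" using M(2) ext by (auto simp: \<A>_def)
    then show ?thesis using M'(3) by blast
  qed
  define \<psi> where "\<psi> x = (SOME a. (x, a) \<in> M)" for x
  have \<psi>: "(x, \<psi> x) \<in> M" if "x \<in> carrier G" for x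
    unfolding \<psi>_def using total [OF that] by (rule someI_ex)
  show thesis
  proof
    show "character G \<psi>"
      unfolding character_def
    proof (intro conjI ballI)
      show "norm (\<psi> x) = 1" if "x \<in> carrier G" for x
        using \<psi> [OF that] graph by (auto simp: character_graph_def)
      show "\<psi> (x \<otimes> y) = \<psi> x * \<psi> y" if "x \<in> carrier G" "y \<in> carrier G" for x y
      proof -
        have "(x \<otimes> y, \<psi> x * \<psi> y) \<in> M"
          using \<psi> [OF that(1)] \<psi> [OF that(2)] graph unfolding character_graph_def by blast
        then show ?thesis using character_graph_unique [OF graph \<psi> [of "x \<otimes> y"]] that by simp
      qed
    qed
    show "\<psi> x = \<phi> x" if "x \<in> H" for x
    proof -
      have "(x, \<phi> x) \<in> M" using ext that by (auto simp: \<Gamma>0_def)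
      then show ?thesis using character_graph_unique [OF graph \<psi>] HG that by blast
    qed
  qed
qed

end

section \<open>Joins of group topologies and the finest null topology\<close>

text \<open>The coarsest topology on the carrier that makes \<open>\<phi>\<close> continuous; it is Hausdorff only if \<open>\<phi>\<close> is injective.\<close>

definition character_topology :: "('a, 'm) monoid_scheme \<Rightarrow> ('a \<Rightarrow> complex) \<Rightarrow> 'a topology" where
  "character_topology G \<phi> = pullback_topology (carrier G) \<phi> euclidean"

definition join_topology :: "'a topology set \<Rightarrow> 'a topology" where
  "join_topology \<T> = topology_generated_by (\<Union>T\<in>\<T>. {U. openin T U})"

lemma openin_join_topology: "T \<in> \<T> \<Longrightarrow> openin T U \<Longrightarrow> openin (join_topology \<T>) U"
  unfolding join_topology_def by (rule topology_generated_by_Basis) blast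

lemma continuous_map_finer_pair:
  assumes "continuous_map (prod_topology T T) T f" and "\<And>U. openin T U \<Longrightarrow> openin S U"
    and "topspace S = topspace T"
  shows "continuous_map (prod_topology S S) T f"
proof -
  have id: "continuous_map S T (\<lambda>x. x)"
    unfolding continuous_map_alt
  proof (intro conjI allI impI)
    fix V assume V: "openin T V"
    then have "(\<lambda>x. x) -` V \<inter> topspace S = V" using openin_subset [OF V] assms(3) by auto
    then show "openin S ((\<lambda>x. x) -` V \<inter> topspace S)" using assms(2) [OF V] by simp
  qed (use assms(3) in auto)
  have "continuous_map (prod_topology S S) (prod_topology T T) (\<lambda>p. (fst p, snd p))"
    by (intro continuous_map_pairedI continuous_map_compose [OF continuous_map_fst id, unfolded o_def]
        continuous_map_compose [OF continuous_map_snd id, unfolded o_def])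
  from continuous_map_compose [OF this assms(1)] show ?thesis by (simp add: o_def)
qed

context group
begin

text \<open>The circle is compact, and preimages of small arcs have differences that \<open>\<phi>\<close> sends near \<open>1\<close>.\<close>

lemma character_topology_totally_bounded:
  assumes \<phi>: "character G \<phi>"
  shows "totally_bounded_group_topology G (character_topology G \<phi>)"
proof -
  let ?T = "character_topology G \<phi>"
  have top: "topspace ?T = carrier G"
    by (simp add: character_topology_def topspace_pullback_topology)
  have cont: "continuous_map ?T euclidean \<phi>"
    unfolding character_topology_def
    using continuous_map_pullback [OF continuous_map_id, of "carrier G" \<phi> euclidean] by simp
  have mult: "continuous_map (prod_topology ?T ?T) ?T (\<lambda>(x, y). x \<otimes> y)"
    unfolding character_topology_def
  proof (rule continuous_map_pullback', fold character_topology_def)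
    have 1: "continuous_map (prod_topology ?T ?T) (prod_topology euclidean euclidean) (\<lambda>p. (\<phi> (fst p), \<phi> (snd p)))"
      by (intro continuous_map_pairedI continuous_map_compose [OF continuous_map_fst cont, unfolded o_def]
        continuous_map_compose [OF continuous_map_snd cont, unfolded o_def])
    have 2: "continuous_map (prod_topology euclidean euclidean) euclidean (\<lambda>p::complex \<times> complex. fst p * snd p)"
      by (simp add: continuous_on_fst continuous_on_snd continuous_on_mult continuous_on_id)
    have "continuous_map (prod_topology ?T ?T) euclidean (\<lambda>p. \<phi> (fst p) * \<phi> (snd p))"
      using continuous_map_compose [OF 1 2] by (simp add: o_def)
    then show "continuous_map (prod_topology ?T ?T) euclidean (\<phi> \<circ> (\<lambda>(x, y). x \<otimes> y))"
    proof (rule continuous_map_eq)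
      fix p assume "p \<in> topspace (prod_topology ?T ?T)"
      then have "fst p \<in> carrier G" "snd p \<in> carrier G"
        unfolding topspace_prod_topology top by (simp_all add: mem_Times_iff)
      then show "\<phi> (fst p) * \<phi> (snd p) = (\<phi> \<circ> (\<lambda>(x, y). x \<otimes> y)) p"
        using \<phi> by (simp add: character_def case_prod_unfold)
    qed
    show "topspace (prod_topology ?T ?T) \<subseteq> (\<lambda>(x, y). x \<otimes> y) -` carrier G" by (auto simp: top)
  qed
  have inv_eq: "\<phi> (inv x) = cnj (\<phi> x)" if "x \<in> carrier G" for x
  proof -
    have "\<phi> x * \<phi> (inv x) = 1"
      using \<phi> that character_one [OF \<phi>] unfolding character_def by (metis inv_closed r_inv)
    moreover have "\<phi> x * cnj (\<phi> x) = 1"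
      using \<phi> that by (simp add: character_def complex_norm_square [symmetric])
    ultimately show ?thesis by (metis mult_cancel_left mult_zero_left zero_neq_one)
  qed
  have inv: "continuous_map ?T ?T (\<lambda>x. inv x)"
    unfolding character_topology_def
  proof (rule continuous_map_pullback', fold character_topology_def)
    have "continuous_map euclidean euclidean cnj" by (simp add: continuous_on_cnj continuous_on_id)
    from continuous_map_compose [OF cont this]
    have "continuous_map ?T euclidean (\<lambda>x. cnj (\<phi> x))" by (simp add: o_def)
    then show "continuous_map ?T euclidean (\<phi> \<circ> (\<lambda>x. inv x))"
      by (rule continuous_map_eq) (auto simp: top inv_eq)
    show "topspace ?T \<subseteq> (\<lambda>x. inv x) -` carrier G" by (auto simp: top)
  qed
  have "small_cover G U" if U: "openin ?T U" "\<one> \<in> U" for U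
  proof -
    obtain A where A: "open A" "U = \<phi> -` A \<inter> carrier G"
      using U(1) by (auto simp: character_topology_def openin_pullback_topology)
    then have "1 \<in> A" using U(2) character_one [OF \<phi>] by auto
    then obtain \<epsilon> where e: "\<epsilon> > 0" "ball 1 \<epsilon> \<subseteq> A" using A(1) open_contains_ball by blast
    have sphere: "compact (sphere (0::complex) 1)" by simp
    have cover: "sphere (0::complex) 1 \<subseteq> (\<Union>z\<in>sphere 0 1. ball z (\<epsilon> / 2))" using e by force
    obtain Z where Z: "Z \<subseteq> sphere 0 1" "finite Z" "sphere (0::complex) 1 \<subseteq> (\<Union>z\<in>Z. ball z (\<epsilon> / 2))"
      by (rule compactE_image [OF sphere _ cover]) auto
    define C where "C z = {x \<in> carrier G. dist z (\<phi> x) < \<epsilon> / 2}" for z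
    have "inv x \<otimes> y \<in> U" if xy: "x \<in> C z" "y \<in> C z" for x y z
    proof -
      have c: "x \<in> carrier G" "y \<in> carrier G" using xy by (auto simp: C_def)
      have "dist (\<phi> x) (\<phi> y) < \<epsilon>"
        using xy dist_triangle3 [of "\<phi> x" "\<phi> y" z] by (simp add: C_def)
      then have "norm (\<phi> (inv x \<otimes> y) - 1) < \<epsilon>"
        using character_diff [OF \<phi> c] by (simp add: dist_norm norm_minus_commute)
      then have "\<phi> (inv x \<otimes> y) \<in> ball 1 \<epsilon>" by (simp add: dist_norm norm_minus_commute)
      then show ?thesis using A e c by auto
    qed
    moreover have "\<Union>(C ` Z) = carrier G"
    proof
      show "carrier G \<subseteq> \<Union>(C ` Z)"
      proof
        fix x assume x: "x \<in> carrier G"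
        then have "\<phi> x \<in> sphere 0 1" using \<phi> by (simp add: character_def)
        then have "\<phi> x \<in> (\<Union>z\<in>Z. ball z (\<epsilon> / 2))" using Z(3) by blast
        then show "x \<in> \<Union>(C ` Z)" using x by (auto simp: C_def)
      qed
    qed (auto simp: C_def)
    ultimately show ?thesis
      unfolding small_cover_def using Z(2) by (intro exI [of _ "C ` Z"]) auto
  qed
  then show ?thesis
    using mult inv top by (simp add: totally_bounded_group_topology_def group_topology_def)
qed

text \<open>The open sets of the join are generated by those of the members, so all three properties can be
  checked on generators. For total boundedness this uses that \<open>small_cover\<close> is stable under finite
  intersections.\<close>

lemma totally_bounded_join_topology:
  assumes "\<T> \<noteq> {}" and \<T>: "\<And>T. T \<in> \<T> \<Longrightarrow> totally_bounded_group_topology G T"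
  shows "totally_bounded_group_topology G (join_topology \<T>)"
proof -
  let ?J = "join_topology \<T>"
  let ?S = "\<Union>T\<in>\<T>. {U. openin T U}"
  have gt: "group_topology G T" if "T \<in> \<T>" for T
    using \<T> [OF that] by (simp add: totally_bounded_group_topology_def)
  have topT: "topspace T = carrier G" if "T \<in> \<T>" for T
    using gt [OF that] by (simp add: group_topology_def)
  have "\<Union>?S = carrier G"
  proof
    show "\<Union>?S \<subseteq> carrier G" using openin_subset topT by fastforce
    obtain T where "T \<in> \<T>" using assms(1) by blast
    then have "carrier G \<in> ?S" using topT openin_topspace by (metis UN_iff mem_Collect_eq)
    then show "carrier G \<subseteq> \<Union>?S" by blast
  qed
  then have top: "topspace ?J = carrier G" by (simp add: join_topology_def)
  have finer: "openin ?J U" if "T \<in> \<T>" "openin T U" for T U using that by (rule openin_join_topology)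
  have "continuous_map (prod_topology ?J ?J) ?J (\<lambda>(x, y). x \<otimes> y)"
    unfolding join_topology_def
  proof (rule continuous_on_generated_topo, fold join_topology_def)
    fix U assume "U \<in> ?S"
    then obtain T where T: "T \<in> \<T>" "openin T U" by blast
    have "continuous_map (prod_topology ?J ?J) T (\<lambda>(x, y). x \<otimes> y)"
    proof (rule continuous_map_finer_pair)
      show "continuous_map (prod_topology T T) T (\<lambda>(x, y). x \<otimes> y)"
        using gt [OF T(1)] by (simp add: group_topology_def)
      show "topspace ?J = topspace T" by (simp only: top topT [OF T(1)])
    qed (rule finer [OF T(1)])
    then show "openin (prod_topology ?J ?J) ((\<lambda>(x, y). x \<otimes> y) -` U \<inter> topspace (prod_topology ?J ?J))"
      using T(2) unfolding continuous_map_alt by blast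
  next
    show "(\<lambda>(x, y). x \<otimes> y) ` topspace (prod_topology ?J ?J) \<subseteq> \<Union>?S"
      unfolding \<open>\<Union>?S = carrier G\<close> by (auto simp: top)
  qed
  moreover have "continuous_map ?J ?J (\<lambda>x. inv x)"
    unfolding join_topology_def
  proof (rule continuous_on_generated_topo, fold join_topology_def)
    fix U assume "U \<in> ?S"
    then obtain T where T: "T \<in> \<T>" "openin T U" by blast
    have "openin T ((\<lambda>x. inv x) -` U \<inter> topspace T)"
      using gt [OF T(1)] T(2) unfolding group_topology_def continuous_map_alt by blast
    then show "openin ?J ((\<lambda>x. inv x) -` U \<inter> topspace ?J)"
      using finer [OF T(1)] by (simp add: top topT [OF T(1)])
  next
    show "(\<lambda>x. inv x) ` topspace ?J \<subseteq> \<Union>?S"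
      unfolding \<open>\<Union>?S = carrier G\<close> by (auto simp: top)
  qed
  moreover have "small_cover G U" if "openin ?J U" "\<one> \<in> U" for U
  proof -
    have "generate_topology_on ?S U"
      using that(1) unfolding join_topology_def by (rule openin_topology_generated_by)
    then show ?thesis using that(2)
    proof (induction)
      case (Int A B)
      then show ?case by (intro small_cover_Int) auto
    next
      case (UN \<K>)
      then obtain K where K: "K \<in> \<K>" "\<one> \<in> K" by blast
      then have "small_cover G K" using UN by blast
      then show ?case by (rule small_cover_mono) (use K(1) in blast)
    next
      case (Basis A)
      then show ?case using \<T> by (auto simp: totally_bounded_group_topology_def)
    qed simp
  qed
  ultimately show ?thesis
    using top by (simp add: totally_bounded_group_topology_def group_topology_def)
qed

lemma limitin_join_topology:
  assumes "\<T> \<noteq> {}" and "\<And>T. T \<in> \<T> \<Longrightarrow> limitin T u l F"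
  shows "limitin (join_topology \<T>) u l F"
  unfolding limitin_def
proof (intro conjI allI impI)
  obtain T where "T \<in> \<T>" using assms(1) by blast
  then have "openin (join_topology \<T>) (topspace T)" "l \<in> topspace T"
    using assms(2) openin_join_topology openin_topspace by (blast, simp add: limitin_def)
  then show "l \<in> topspace (join_topology \<T>)" using openin_subset by blast
  fix U assume U: "openin (join_topology \<T>) U \<and> l \<in> U"
  then have "generate_topology_on (\<Union>T\<in>\<T>. {U. openin T U}) U"
    unfolding join_topology_def by (blast intro: openin_topology_generated_by)
  then show "\<forall>\<^sub>F n in F. u n \<in> U" using U [THEN conjunct2]
  proof (induction)
    case (Int A B)
    then show ?case by (simp add: eventually_conj)
  next
    case (UN \<K>)
    then obtain K where K: "K \<in> \<K>" "l \<in> K" by blast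
    then have "\<forall>\<^sub>F n in F. u n \<in> K" using UN by blast
    then show ?case by (rule eventually_mono) (use K in blast)
  next
    case (Basis A)
    then show ?case using assms(2) by (auto simp: limitin_def)
  qed simp
qed

lemma precompact_null_join_topology:
  assumes T: "T \<in> \<T>" "Hausdorff_space T"
    and \<T>: "\<And>T. T \<in> \<T> \<Longrightarrow> totally_bounded_group_topology G T" "\<And>T. T \<in> \<T> \<Longrightarrow> limitin T u \<one> sequentially"
  shows "precompact_null_topology G u (join_topology \<T>)"
proof -
  have ne: "\<T> \<noteq> {}" using T by blast
  have J: "totally_bounded_group_topology G (join_topology \<T>)"
    using ne \<T>(1) by (rule totally_bounded_join_topology)
  have "topspace (join_topology \<T>) = topspace T"
    using J \<T>(1) [OF T(1)] by (simp add: totally_bounded_group_topology_def group_topology_def)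
  then have "Hausdorff_space (join_topology \<T>)"
    using T(2) openin_join_topology [OF T(1)] unfolding Hausdorff_space_def by metis
  then show ?thesis
    using J limitin_join_topology [OF ne \<T>(2)]
    by (simp add: precompact_null_topology_def precompact_iff_totally_bounded)
qed

text \<open>The join of all precompact topologies in which \<open>u\<close> is null is again one of them, so the
  definite description in \<open>TB_topology\<close> is proper.\<close>

lemma TB_topology_finest:
  assumes "precompact_null_topology G u T"
  shows "precompact_null_topology G u (TB_topology G u)"
    and "\<And>S U. precompact_null_topology G u S \<Longrightarrow> openin S U \<Longrightarrow> openin (TB_topology G u) U"
proof -
  let ?P = "\<lambda>T. precompact_null_topology G u T \<and>
        (\<forall>S. precompact_null_topology G u S \<longrightarrow> (\<forall>U. openin S U \<longrightarrow> openin T U))"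
  let ?\<T> = "{T. precompact_null_topology G u T}"
  have J: "?P (join_topology ?\<T>)"
  proof (intro conjI allI impI)
    show "precompact_null_topology G u (join_topology ?\<T>)"
      using assms
      by (intro precompact_null_join_topology [of T])
        (auto simp: precompact_null_topology_def precompact_iff_totally_bounded)
  qed (auto intro: openin_join_topology)
  have unique: "T = T'" if "?P T" "?P T'" for T T'
    using that by (intro topology_eq [THEN iffD2]) blast
  have "?P (TB_topology G u)"
    unfolding TB_topology_def by (rule theI [of ?P, OF J]) (rule unique [OF _ J])
  then show "precompact_null_topology G u (TB_topology G u)"
    "\<And>S U. precompact_null_topology G u S \<Longrightarrow> openin S U \<Longrightarrow> openin (TB_topology G u) U" by blast+
qed

lemma TB_topology_eqI:
  assumes "precompact_null_topology G v (TB_topology G u)" "precompact_null_topology G u (TB_topology G v)"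
  shows "TB_topology G u = TB_topology G v"
  using TB_topology_finest(2) [OF assms(1) assms(1)] TB_topology_finest(2) [OF assms(2) assms(2)]
  by (intro topology_eq [THEN iffD2]) blast

lemma precompact_null_subtopology:
  assumes H: "subgroup H G" and u: "range u \<subseteq> H" and T: "precompact_null_topology G u T"
  shows "precompact_null_topology (G\<lparr>carrier := H\<rparr>) u (subtopology T H)"
proof -
  let ?H = "G\<lparr>carrier := H\<rparr>" and ?T = "subtopology T H"
  interpret H: group ?H using H by (rule subgroup_imp_group)
  have HG: "H \<subseteq> carrier G" using H by (rule subgroup.subset)
  have tb: "totally_bounded_group_topology G T" and haus: "Hausdorff_space T" and lim: "limitin T u \<one> sequentially"
    using T by (auto simp: precompact_null_topology_def precompact_iff_totally_bounded)
  have gt: "group_topology G T" using tb by (simp add: totally_bounded_group_topology_def)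
  have top: "topspace T = carrier G" using gt by (simp add: group_topology_def)
  have topH: "topspace ?T = H" using HG top by auto
  have "continuous_map (prod_topology ?T ?T) ?T (\<lambda>(x, y). x \<otimes> y)"
  proof (rule continuous_map_into_subtopology)
    have "continuous_map (subtopology (prod_topology T T) (H \<times> H)) T (\<lambda>(x, y). x \<otimes> y)"
      using gt by (intro continuous_map_from_subtopology) (simp add: group_topology_def)
    then show "continuous_map (prod_topology ?T ?T) T (\<lambda>(x, y). x \<otimes> y)"
      by (simp add: subtopology_Times)
  qed (use topH subgroup.m_closed [OF H] in auto)
  moreover have "continuous_map ?T ?T (\<lambda>x. inv x)"
    using gt topH subgroup.m_inv_closed [OF H]
    by (intro continuous_map_into_subtopology continuous_map_from_subtopology) (auto simp: group_topology_def)
  then have "continuous_map ?T ?T (\<lambda>x. inv\<^bsub>?H\<^esub> x)"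
    by (rule continuous_map_eq) (simp add: topH m_inv_consistent [OF H])
  moreover have "small_cover ?H U" if U: "openin ?T U" "\<one> \<in> U" for U
  proof -
    obtain A where A: "openin T A" "U = A \<inter> H" using U(1) by (auto simp: openin_subtopology)
    then have "small_cover G A" using tb U(2) by (simp add: totally_bounded_group_topology_def)
    then obtain \<C> where C: "finite \<C>" "\<Union>\<C> = carrier G" "\<forall>C\<in>\<C>. \<forall>x\<in>C. \<forall>y\<in>C. inv x \<otimes> y \<in> A"
      by (rule small_coverE)
    have "inv\<^bsub>?H\<^esub> x \<otimes> y \<in> U" if "C \<in> \<C>" "x \<in> C \<inter> H" "y \<in> C \<inter> H" for C x y
      using C(3) that A(2) subgroup.m_closed [OF H] subgroup.m_inv_closed [OF H]
      by (auto simp: m_inv_consistent [OF H])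
    moreover have "(\<Union>C\<in>\<C>. C \<inter> H) = H" using C(2) HG by blast
    ultimately show ?thesis
      unfolding small_cover_def using C(1) by (intro exI [of _ "(\<lambda>C. C \<inter> H) ` \<C>"]) auto
  qed
  ultimately have "totally_bounded_group_topology ?H ?T"
    by (simp add: totally_bounded_group_topology_def group_topology_def topH del: topspace_subtopology)
  moreover have "Hausdorff_space ?T" using haus by (rule Hausdorff_space_subtopology)
  moreover have "limitin ?T u \<one> sequentially"
    using lim u subgroup.one_closed [OF H] by (auto simp: limitin_subtopology intro!: always_eventually)
  ultimately show ?thesis
    by (simp add: precompact_null_topology_def H.precompact_iff_totally_bounded)
qed

end

section \<open>Passage between a group and a subgroup\<close>

text \<open>A continuous character of \<open>(H, S)\<close> extends to \<open>G\<close>, and the extension is continuous for the finest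
  topology \<open>TB_topology G u\<close>, since joining it to that topology keeps \<open>u\<close> null. Hence every continuous
  character of \<open>(H, S)\<close> is \<open>1\<close> in the limit along \<open>v\<close>, and these characters determine \<open>S\<close>.\<close>

lemma (in comm_group) null_sequence_transfer_to_subgroup:
  assumes H: "subgroup H G" and u: "range u \<subseteq> H" and v: "range v \<subseteq> H"
    and T: "precompact_null_topology G u T" and v_null: "limitin (TB_topology G u) v \<one> sequentially"
    and S: "precompact_null_topology (G\<lparr>carrier := H\<rparr>) u S"
  shows "precompact_null_topology (G\<lparr>carrier := H\<rparr>) v S"
proof -
  let ?H = "G\<lparr>carrier := H\<rparr>"
  have HG: "H \<subseteq> carrier G" using H by (rule subgroup.subset)
  have "comm_group ?H"
    using HG by (intro group.group_comm_groupI subgroup_imp_group H) (auto intro: m_comm)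
  then interpret H: comm_group ?H .
  have S': "totally_bounded_group_topology ?H S" "limitin S u \<one> sequentially"
    using S by (auto simp: precompact_null_topology_def H.precompact_iff_totally_bounded)
  have char_null: "\<forall>\<^sub>F n in sequentially. norm (\<phi> (v n) - 1) < \<delta>"
    if \<phi>: "continuous_character ?H S \<phi>" and "\<delta> > 0" for \<phi> \<delta>
  proof -
    have "character ?H \<phi>" using \<phi> by (simp add: continuous_character_def)
    then obtain \<psi> where \<psi>: "character G \<psi>" "\<And>x. x \<in> H \<Longrightarrow> \<psi> x = \<phi> x"
      using character_extension [OF H] by blast
    let ?C = "character_topology G \<psi>"
    have "limitin ?C u \<one> sequentially"
      unfolding limitin_def
    proof (intro conjI allI impI)
      show "\<one> \<in> topspace ?C" by (simp add: character_topology_def topspace_pullback_topology)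
      fix U assume U: "openin ?C U \<and> \<one> \<in> U"
      then obtain A where A: "open A" "U = \<psi> -` A \<inter> carrier G"
        by (auto simp: character_topology_def openin_pullback_topology)
      then have "1 \<in> A" using U character_one [OF \<psi>(1)] by auto
      then obtain \<epsilon> where e: "\<epsilon> > 0" "ball 1 \<epsilon> \<subseteq> A" using A(1) open_contains_ball by blast
      then obtain W where W: "openin S W" "\<one> \<in> W" "\<forall>w\<in>W. norm (\<phi> w - 1) < \<epsilon>"
        using \<phi> by (auto simp: continuous_character_def)
      have "\<forall>\<^sub>F n in sequentially. u n \<in> W" using S'(2) W by (simp add: limitin_def)
      then show "\<forall>\<^sub>F n in sequentially. u n \<in> U"
      proof (rule eventually_mono)
        fix n assume "u n \<in> W"
        moreover have un: "u n \<in> H" using u by auto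
        ultimately have "\<psi> (u n) \<in> ball 1 \<epsilon>"
          using W(3) \<psi>(2) by (simp add: dist_norm norm_minus_commute)
        then show "u n \<in> U" using A(2) e(2) un HG by blast
      qed
    qed
    moreover have "precompact_null_topology G u (TB_topology G u)" using T by (rule TB_topology_finest)
    ultimately have "precompact_null_topology G u (join_topology {TB_topology G u, ?C})"
      using character_topology_totally_bounded [OF \<psi>(1)]
      by (intro precompact_null_join_topology [of "TB_topology G u"])
        (auto simp: precompact_null_topology_def precompact_iff_totally_bounded)
    then have finer: "openin (TB_topology G u) U" if "openin ?C U" for U
      by (rule TB_topology_finest(2) [OF T]) (rule openin_join_topology [OF _ that], simp)
    have "openin ?C (\<psi> -` ball 1 \<delta> \<inter> carrier G)"
      unfolding character_topology_def openin_pullback_topology by auto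
    then have "openin (TB_topology G u) (\<psi> -` ball 1 \<delta> \<inter> carrier G)" by (rule finer)
    moreover have "\<one> \<in> \<psi> -` ball 1 \<delta> \<inter> carrier G"
      using character_one [OF \<psi>(1)] \<open>\<delta> > 0\<close> by simp
    ultimately have "\<forall>\<^sub>F n in sequentially. v n \<in> \<psi> -` ball 1 \<delta> \<inter> carrier G"
      using v_null unfolding limitin_def by blast
    then show ?thesis
    proof (rule eventually_mono)
      fix n assume "v n \<in> \<psi> -` ball 1 \<delta> \<inter> carrier G"
      moreover have "v n \<in> H" using v by auto
      ultimately show "norm (\<phi> (v n) - 1) < \<delta>"
        using \<psi>(2) by (simp add: dist_norm norm_minus_commute)
    qed
  qed
  have "limitin S v \<one> sequentially"
    unfolding limitin_def
  proof (intro conjI allI impI)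
    show "\<one> \<in> topspace S" using S'(2) by (simp add: limitin_def)
    fix U assume U: "openin S U \<and> \<one> \<in> U"
    then obtain Y \<delta> where Y: "finite Y" "\<And>\<phi>. \<phi> \<in> Y \<Longrightarrow> continuous_character ?H S \<phi>" "\<delta> > 0"
      "\<And>x. x \<in> H \<Longrightarrow> (\<And>\<phi>. \<phi> \<in> Y \<Longrightarrow> norm (\<phi> x - 1) < \<delta>) \<Longrightarrow> x \<in> U"
      using H.characters_determine_totally_bounded_topology [OF S'(1), of U] by auto
    have "\<forall>\<^sub>F n in sequentially. \<forall>\<phi>\<in>Y. norm (\<phi> (v n) - 1) < \<delta>"
      using Y(1-3) char_null by (intro eventually_ball_finite) auto
    then show "\<forall>\<^sub>F n in sequentially. v n \<in> U"
      by (rule eventually_mono) (use Y(4) v in blast)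
  qed
  then show ?thesis using S by (simp add: precompact_null_topology_def)
qed

theorem corollary1p8:
  fixes G :: "('a, 'm) monoid_scheme" and u v :: "nat \<Rightarrow> 'a" and H :: "'a set"
  assumes "comm_group G"
    and "TB_sequence G u" and "TB_sequence G v"
    and "subgroup H G" and "range u \<subseteq> H" and "range v \<subseteq> H"
  shows "TB_topology G u = TB_topology G v \<longleftrightarrow>
         TB_topology (G\<lparr>carrier := H\<rparr>) u = TB_topology (G\<lparr>carrier := H\<rparr>) v"
proof -
  let ?H = "G\<lparr>carrier := H\<rparr>"
  interpret comm_group G by fact
  interpret H: group ?H using assms(4) by (rule subgroup_imp_group)
  note sub = precompact_null_subtopology [OF assms(4)]
  obtain Tu Tv where T: "precompact_null_topology G u Tu" "precompact_null_topology G v Tv"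
    using assms(2,3) by (auto simp: TB_sequence_def)
  note G_fin = TB_topology_finest(1) [OF T(1)] TB_topology_finest(1) [OF T(2)]
  note H_sub = sub [OF assms(5) G_fin(1)] sub [OF assms(6) G_fin(2)]
  note H_fin = H.TB_topology_finest(1) [OF H_sub(1)] H.TB_topology_finest(1) [OF H_sub(2)]
  show ?thesis
  proof
    assume eq: "TB_topology G u = TB_topology G v"
    have "limitin (TB_topology G u) v \<one>\<^bsub>G\<^esub> sequentially" "limitin (TB_topology G v) u \<one>\<^bsub>G\<^esub> sequentially"
      using G_fin by (auto simp: precompact_null_topology_def eq)
    then show "TB_topology ?H u = TB_topology ?H v"
      using null_sequence_transfer_to_subgroup [OF assms(4,5,6) T(1) _ H_fin(1)]
        null_sequence_transfer_to_subgroup [OF assms(4,6,5) T(2) _ H_fin(2)]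
      by (intro H.TB_topology_eqI)
  next
    assume eq: "TB_topology ?H u = TB_topology ?H v"
    have null: "precompact_null_topology G b (TB_topology G a)"
      if a: "precompact_null_topology G a (TB_topology G a)"
        "precompact_null_topology ?H a (subtopology (TB_topology G a) H)"
        "precompact_null_topology ?H b (TB_topology ?H a)" for a b
    proof -
      have "openin (TB_topology ?H a) U" if "openin (subtopology (TB_topology G a) H) U" for U
        using H.TB_topology_finest(2) [OF a(2) a(2) that] .
      moreover have "limitin (TB_topology ?H a) b \<one>\<^bsub>G\<^esub> sequentially"
        using a(3) by (simp add: precompact_null_topology_def)
      moreover have "\<one>\<^bsub>G\<^esub> \<in> topspace (subtopology (TB_topology G a) H)"
        using a(2) by (simp add: precompact_null_topology_def limitin_def)
      ultimately have "limitin (subtopology (TB_topology G a) H) b \<one>\<^bsub>G\<^esub> sequentially"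
        by (simp add: limitin_def del: topspace_subtopology)
      then have "limitin (TB_topology G a) b \<one>\<^bsub>G\<^esub> sequentially" by (simp add: limitin_subtopology)
      then show ?thesis using a(1) by (simp add: precompact_null_topology_def)
    qed
    have "precompact_null_topology G v (TB_topology G u)"
      by (rule null [OF G_fin(1) H_sub(1)]) (use H_fin(2) eq in simp)
    moreover have "precompact_null_topology G u (TB_topology G v)"
      by (rule null [OF G_fin(2) H_sub(2)]) (use H_fin(1) eq in simp)
    ultimately show "TB_topology G u = TB_topology G v" by (rule TB_topology_eqI)
  qed
qed

end
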